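(* Let $w\in S_\infty$ with $\mathrm{maxd}(w)\le n$. Then in $\mathcal D_n\otimes\mathcal D_n$, $$\Delta^*(\Xi_w^n)=\sum_{u,v}c_{u,v}^w\,\Xi_u^n\otimes\Xi_v^n,$$ where $c_{u,v}^w$ are the Schubert structure constants, $\mathfrak S_u\mathfrak S_v=\sum_wc_{u,v}^w\mathfrak S_w$, and the sum runs over pairs $u,v\in S_\infty$ with $\mathrm{maxd}(u),\mathrm{maxd}(v)\le n$.
   Context: $S_\infty$ is the group of permutations of $\mathbb Z_{>0}$ fixing all but finitely many points; $\mathrm{maxd}(w)=\max\{i:w(i)>w(i+1)\}$ ($0$ for the identity); $\mathfrak S_w$ is the Schubert polynomial. $\mathcal D_n$ is the free abelian group on weak compositions $[a]$ of length $n$, paired with $\mathbb Z[x_1,\dots,x_n]$ by $\langle[a],x^b\rangle=\delta_{a,b}$. $\Xi_u^n\in\mathcal D_n$ is determined by $\langle\Xi_u^n,\mathfrak S_v\rangle=\delta_{u,v}$ for all $v$ with $\mathrm{maxd}(v)\le n$. $\Delta^*:\mathcal D_n\to\mathcal D_n\otimes\mathcal D_n$ is the coproduct dual to polynomial multiplication: $\langle\Delta^*(\alpha),f\otimes g\rangle=\langle\alpha,fg\rangle$ for $f,g\in\mathbb Z[x_1,\dots,x_n]$; explicitly $\Delta^*([c])=\sum_{a+b=c}[a]\otimes[b]$ over weak compositions $a,b$ of length $n$. *)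

theory Defs
  imports
    "HOL-Combinatorics.Permutations"
    "HOL-Library.Poly_Mapping"
    "HOL-Algebra.Free_Abelian_Groups"
begin

section \<open>Permutations\<close>

definition S_inf :: "(nat \<Rightarrow> nat) set" where
  "S_inf = {w. w permutes {1..} \<and> finite {i. w i \<noteq> i}}"

definition maxd :: "(nat \<Rightarrow> nat) \<Rightarrow> nat" where
  "maxd w = Max (insert 0 {i. 1 \<le> i \<and> w i > w (Suc i)})"

definition longest_perm :: "nat \<Rightarrow> nat \<Rightarrow> nat" where
  "longest_perm m i = (if i \<in> {1..m} then m + 1 - i else i)"


section \<open>Polynomials and Schubert polynomials\<close>

text \<open>
  Polynomials over the integers in \<open>x\<^sub>1, x\<^sub>2, \<dots>\<close>: the exponent vector \<open>a\<close> stands for the monomial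
  \<open>x\<^sup>a\<close>, \<open>lookup f a\<close> is the coefficient of \<open>x\<^sup>a\<close> in \<open>f\<close>, and the ring
  structure is the convolution product on \<open>poly_mapping\<close>. The index \<open>0\<close> is never used.
\<close>

type_synonym expvec = "nat \<Rightarrow>\<^sub>0 nat"
type_synonym mpoly = "expvec \<Rightarrow>\<^sub>0 int"

definition var :: "nat \<Rightarrow> mpoly" where
  "var i = Poly_Mapping.single (Poly_Mapping.single i 1) 1"

text \<open>Interchange of \<open>x\<^sub>i\<close> and \<open>x\<^sub>i\<^sub>+\<^sub>1\<close>; both transports act by precomposition with an involution.\<close>

definition swap_vars :: "nat \<Rightarrow> mpoly \<Rightarrow> mpoly" where
  "swap_vars i f = Poly_Mapping.map_key (Poly_Mapping.map_key (transpose i (Suc i))) f"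

text \<open>\<open>(f - s\<^sub>i f) / (x\<^sub>i - x\<^sub>i\<^sub>+\<^sub>1)\<close>; the quotient exists, and is unique since \<^typ>\<open>mpoly\<close> is an integral domain.\<close>

definition div_diff :: "nat \<Rightarrow> mpoly \<Rightarrow> mpoly" where
  "div_diff i f = (THE g. (var i - var (Suc i)) * g = f - swap_vars i f)"

text \<open>
  The Lascoux--Schuetzenberger definition: \<open>x\<^sub>1\<^bsup>m-1\<^esup> x\<^sub>2\<^bsup>m-2\<^esup> \<cdots> x\<^sub>m\<^sub>-\<^sub>1\<close> for the longest element of \<open>S\<^sub>m\<close>
  (for every \<open>m\<close>), and then \<open>\<partial>\<^sub>i\<close> takes the polynomial of \<open>w\<close> to that of \<open>w s\<^sub>i\<close> whenever
  \<open>w(i) > w(i+1)\<close>. That the result depends on \<open>w\<close> only, and not on \<open>m\<close> or on the chain of descents, is the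
  classical well-definedness of Schubert polynomials.
\<close>

inductive is_schubert :: "(nat \<Rightarrow> nat) \<Rightarrow> mpoly \<Rightarrow> bool" where
  longest: "is_schubert (longest_perm m) (\<Prod>i\<in>{1..m}. var i ^ (m - i))"
| descent: "\<lbrakk>is_schubert w f; 1 \<le> i; w i > w (Suc i)\<rbrakk>
    \<Longrightarrow> is_schubert (w \<circ> transpose i (Suc i)) (div_diff i f)"

definition schubert :: "(nat \<Rightarrow> nat) \<Rightarrow> mpoly" where
  "schubert w = (THE f. is_schubert w f)"

text \<open>
  \<open>c\<^sup>w\<^sub>u\<^sub>,\<^sub>v\<close>: the coefficients of the expansion of \<open>\<SS>\<^sub>u \<SS>\<^sub>v\<close> in the basis of all Schubert polynomials.
\<close>

definition schubert_coeff :: "(nat \<Rightarrow> nat) \<Rightarrow> (nat \<Rightarrow> nat) \<Rightarrow> (nat \<Rightarrow> nat) \<Rightarrow> int" where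
  "schubert_coeff u v = Poly_Mapping.lookup (THE c. Poly_Mapping.keys c \<subseteq> S_inf \<and>
     schubert u * schubert v = (\<Sum>w\<in>Poly_Mapping.keys c. of_int (Poly_Mapping.lookup c w) * schubert w))"


section \<open>The dual group\<close>

text \<open>
  A weak composition \<open>(a\<^sub>1, \<dots>, a\<^sub>n)\<close> is encoded as the exponent vector \<open>i \<mapsto> a\<^sub>i\<close> supported in \<open>{1..n}\<close>, so
  that \<open>[a]\<close> is \<^term>\<open>frag_of a\<close> and the monomials of \<open>\<int>[x\<^sub>1, \<dots>, x\<^sub>n]\<close> are those with exponent in
  \<open>weak_comps n\<close>.
\<close>

definition weak_comps :: "nat \<Rightarrow> expvec set" where
  "weak_comps n = {a. Poly_Mapping.keys a \<subseteq> {1..n}}"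

definition dual_group :: "nat \<Rightarrow> (expvec \<Rightarrow>\<^sub>0 int) monoid" (\<open>\<D>\<close>) where
  "\<D> n = free_Abelian_group (weak_comps n)"

text \<open>The bilinear extension of \<open>\<langle>[a], x\<^sup>b\<rangle> = \<delta>\<^sub>a\<^sub>,\<^sub>b\<close>.\<close>

definition pairing :: "(expvec \<Rightarrow>\<^sub>0 int) \<Rightarrow> mpoly \<Rightarrow> int" where
  "pairing \<alpha> f = (\<Sum>a\<in>Poly_Mapping.keys \<alpha>. Poly_Mapping.lookup \<alpha> a * Poly_Mapping.lookup f a)"

definition dual_schubert :: "nat \<Rightarrow> (nat \<Rightarrow> nat) \<Rightarrow> (expvec \<Rightarrow>\<^sub>0 int)" (\<open>\<Xi>\<close>) where
  "\<Xi> n u = (THE \<alpha>. \<alpha> \<in> carrier (\<D> n) \<and>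
     (\<forall>v\<in>S_inf. maxd v \<le> n \<longrightarrow> pairing \<alpha> (schubert v) = (if u = v then 1 else 0)))"


section \<open>Tensor products of abelian groups\<close>

text \<open>
  The free abelian group on \<open>G \<times> H\<close> modulo the bilinearity relations. As everywhere in \<open>HOL-Algebra\<close>'s
  theory of groups, these abelian groups are written multiplicatively: sums are (g)finprod, and an
  integer multiple is a power.
\<close>

definition tensor_relations ::
    "('a, 'c) monoid_scheme \<Rightarrow> ('b, 'd) monoid_scheme \<Rightarrow> ('a \<times> 'b \<Rightarrow>\<^sub>0 int) set" where
  "tensor_relations G H =
     {frag_of (x \<otimes>\<^bsub>G\<^esub> x', y) - frag_of (x, y) - frag_of (x', y) | x x' y.
        x \<in> carrier G \<and> x' \<in> carrier G \<and> y \<in> carrier H} \<union>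
     {frag_of (x, y \<otimes>\<^bsub>H\<^esub> y') - frag_of (x, y) - frag_of (x, y') | x y y'.
        x \<in> carrier G \<and> y \<in> carrier H \<and> y' \<in> carrier H}"

definition tensor_kernel ::
    "('a, 'c) monoid_scheme \<Rightarrow> ('b, 'd) monoid_scheme \<Rightarrow> ('a \<times> 'b \<Rightarrow>\<^sub>0 int) set" where
  "tensor_kernel G H =
     generate (free_Abelian_group (carrier G \<times> carrier H)) (tensor_relations G H)"

definition tensor_group ::
    "('a, 'c) monoid_scheme \<Rightarrow> ('b, 'd) monoid_scheme \<Rightarrow> ('a \<times> 'b \<Rightarrow>\<^sub>0 int) set monoid" where
  "tensor_group G H = free_Abelian_group (carrier G \<times> carrier H) Mod tensor_kernel G H"

definition tensor ::
    "('a, 'c) monoid_scheme \<Rightarrow> ('b, 'd) monoid_scheme \<Rightarrow> 'a \<Rightarrow> 'b \<Rightarrow> ('a \<times> 'b \<Rightarrow>\<^sub>0 int) set" where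
  "tensor G H x y =
     tensor_kernel G H #>\<^bsub>free_Abelian_group (carrier G \<times> carrier H)\<^esub> frag_of (x, y)"


section \<open>The coproduct\<close>

type_synonym tensor_elt = "((expvec \<Rightarrow>\<^sub>0 int) \<times> (expvec \<Rightarrow>\<^sub>0 int) \<Rightarrow>\<^sub>0 int) set"

abbreviation dual_tensor_group :: "nat \<Rightarrow> tensor_elt monoid" (\<open>\<D>\<D>\<close>) where
  "\<D>\<D> n \<equiv> tensor_group (\<D> n) (\<D> n)"

text \<open>
  The linear extension of \<open>[c] \<mapsto> \<Sum>\<^bsub>a+b=c\<^esub> [a] \<otimes> [b]\<close>. Lemma \<open>tensor_pairing_coproduct\<close> below shows that this
  is the map dual to multiplication of polynomials.
\<close>

definition coproduct :: "nat \<Rightarrow> (expvec \<Rightarrow>\<^sub>0 int) \<Rightarrow> tensor_elt" where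
  "coproduct n \<alpha> = finprod (\<D>\<D> n)
     (\<lambda>c. (finprod (\<D>\<D> n)
            (\<lambda>(a, b). tensor (\<D> n) (\<D> n) (frag_of a) (frag_of b))
            {(a, b). a \<in> weak_comps n \<and> b \<in> weak_comps n \<and> a + b = c})
          [^]\<^bsub>\<D>\<D> n\<^esub> Poly_Mapping.lookup \<alpha> c)
     (Poly_Mapping.keys \<alpha>)"


section \<open>Duality of the coproduct and multiplication\<close>

definition int_extend :: "('a \<Rightarrow> int) \<Rightarrow> ('a \<Rightarrow>\<^sub>0 int) \<Rightarrow> int" where
  "int_extend h x = (\<Sum>k\<in>Poly_Mapping.keys x. Poly_Mapping.lookup x k * h k)"

text \<open>
  The value \<open>\<langle>T, f \<otimes> g\<rangle>\<close>, induced by \<open>\<langle>\<alpha> \<otimes> \<beta>, f \<otimes> g\<rangle> = \<langle>\<alpha>, f\<rangle> \<langle>\<beta>, g\<rangle>\<close>: the common value of the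
  linear extension on the coset \<open>T\<close>.
\<close>

definition tensor_pairing :: "tensor_elt \<Rightarrow> mpoly \<Rightarrow> mpoly \<Rightarrow> int" where
  "tensor_pairing T f g = the_elem (int_extend (\<lambda>(\<alpha>, \<beta>). pairing \<alpha> f * pairing \<beta> g) ` T)"

lemma int_extend_superset:
  assumes "finite A" "Poly_Mapping.keys x \<subseteq> A"
  shows "int_extend h x = (\<Sum>k\<in>A. Poly_Mapping.lookup x k * h k)"
  unfolding int_extend_def
  by (rule sum.mono_neutral_left) (use assms in \<open>auto simp: in_keys_iff\<close>)

lemma int_extend_add: "int_extend h (x + y) = int_extend h x + int_extend h y"
proof -
  let ?A = "Poly_Mapping.keys x \<union> Poly_Mapping.keys y"
  have "Poly_Mapping.keys (x + y) \<subseteq> ?A"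
    by (rule keys_add)
  then show ?thesis
    by (simp add: int_extend_superset[of ?A] lookup_add distrib_right sum.distrib)
qed

lemma int_extend_minus: "int_extend h (- x) = - int_extend h x"
  by (simp add: int_extend_def sum_negf)

lemma int_extend_diff: "int_extend h (x - y) = int_extend h x - int_extend h y"
  using int_extend_add[of h x "- y"] by (simp add: int_extend_minus)

lemma int_extend_frag_of [simp]: "int_extend h (frag_of k) = h k"
  by (simp add: int_extend_def)

lemma pairing_eq_int_extend: "pairing \<alpha> f = int_extend (Poly_Mapping.lookup f) \<alpha>"
  by (simp add: pairing_def int_extend_def)

lemma pairing_add: "pairing (\<alpha> + \<beta>) f = pairing \<alpha> f + pairing \<beta> f"
  by (simp add: pairing_eq_int_extend int_extend_add)

lemma pairing_frag_of [simp]: "pairing (frag_of a) f = Poly_Mapping.lookup f a"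
  by (simp add: pairing_eq_int_extend)

lemma tensor_relations_subset:
  assumes "group G" "group H"
  shows "tensor_relations G H \<subseteq> carrier (free_Abelian_group (carrier G \<times> carrier H))"
proof -
  interpret G: group G by fact
  interpret H: group H by fact
  have *: "Poly_Mapping.keys (frag_of p - frag_of q - frag_of r) \<subseteq> S"
    if "p \<in> S" "q \<in> S" "r \<in> S" for p q r :: "'a \<times> 'c" and S
    using keys_diff[of "frag_of p - frag_of q" "frag_of r"] keys_diff[of "frag_of p" "frag_of q"] that
    by (auto simp: keys_frag_of)
  show ?thesis
  proof (rule subsetI)
    fix z assume "z \<in> tensor_relations G H"
    then obtain p q r where z: "z = frag_of p - frag_of q - frag_of r"
      and pqr: "p \<in> carrier G \<times> carrier H" "q \<in> carrier G \<times> carrier H" "r \<in> carrier G \<times> carrier H"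
      unfolding tensor_relations_def by blast
    show "z \<in> carrier (free_Abelian_group (carrier G \<times> carrier H))"
      unfolding z carrier_free_Abelian_group_iff by (rule *[OF pqr])
  qed
qed

lemma tensor_kernel_normal:
  assumes "group G" "group H"
  shows "tensor_kernel G H \<lhd> free_Abelian_group (carrier G \<times> carrier H)"
  unfolding tensor_kernel_def
  by (intro comm_group.subgroup_imp_normal abelian_free_Abelian_group group.generate_is_subgroup
      tensor_relations_subset assms) simp

lemma comm_group_tensor_group:
  assumes "group G" "group H"
  shows "comm_group (tensor_group G H)"
  unfolding tensor_group_def
  by (intro comm_group.abelian_FactGroup abelian_free_Abelian_group normal_imp_subgroup
      tensor_kernel_normal assms)

lemma group_dual_group [simp]: "group (\<D> n)"
  by (simp add: dual_group_def)

lemma int_extend_tensor_kernel: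
  assumes "x \<in> tensor_kernel (\<D> n) (\<D> n)"
  shows "int_extend (\<lambda>(\<alpha>, \<beta>). pairing \<alpha> f * pairing \<beta> g) x = 0"
proof -
  let ?h = "\<lambda>(\<alpha>, \<beta>). pairing \<alpha> f * pairing \<beta> g"
  let ?R = "tensor_relations (\<D> n) (\<D> n)"
  let ?F = "free_Abelian_group (carrier (\<D> n) \<times> carrier (\<D> n))"
  have R: "int_extend ?h r = 0" if "r \<in> ?R" for r
    using that unfolding tensor_relations_def
    by (elim UnE CollectE exE conjE)
      (simp_all add: int_extend_diff pairing_add dual_group_def distrib_left distrib_right)
  show ?thesis
    using assms unfolding tensor_kernel_def
  proof (induction rule: generate.induct)
    case one
    then show ?case by (simp add: int_extend_def)
  next
    case (incl r)
    then show ?case by (rule R)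
  next
    case (inv r)
    have "r \<in> carrier ?F"
      by (rule subsetD[OF tensor_relations_subset inv]) simp_all
    then show ?case
      using R[OF inv] by (simp add: int_extend_minus)
  next
    case (eng x y)
    then show ?case by (simp add: int_extend_add)
  qed
qed

lemma tensor_pairing_coset:
  "tensor_pairing (tensor_kernel (\<D> n) (\<D> n) #>\<^bsub>free_Abelian_group (carrier (\<D> n) \<times> carrier (\<D> n))\<^esub> x) f g
     = int_extend (\<lambda>(\<alpha>, \<beta>). pairing \<alpha> f * pairing \<beta> g) x"
proof -
  let ?N = "tensor_kernel (\<D> n) (\<D> n)"
  have "0 \<in> ?N"
    unfolding tensor_kernel_def
    using generate.one[of "free_Abelian_group (carrier (\<D> n) \<times> carrier (\<D> n))"] by simp
  moreover have "int_extend (\<lambda>(\<alpha>, \<beta>). pairing \<alpha> f * pairing \<beta> g) (z + x)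
      = int_extend (\<lambda>(\<alpha>, \<beta>). pairing \<alpha> f * pairing \<beta> g) x" if "z \<in> ?N" for z
    using int_extend_tensor_kernel[OF that] by (simp add: int_extend_add)
  ultimately have "int_extend (\<lambda>(\<alpha>, \<beta>). pairing \<alpha> f * pairing \<beta> g) `
      (?N #>\<^bsub>free_Abelian_group (carrier (\<D> n) \<times> carrier (\<D> n))\<^esub> x)
      = {int_extend (\<lambda>(\<alpha>, \<beta>). pairing \<alpha> f * pairing \<beta> g) x}"
    unfolding r_coset_def by auto
  then show ?thesis
    by (simp add: tensor_pairing_def)
qed

lemma tensor_pairing_tensor:
  "tensor_pairing (tensor (\<D> n) (\<D> n) \<alpha> \<beta>) f g = pairing \<alpha> f * pairing \<beta> g"
  by (simp add: tensor_def tensor_pairing_coset)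

lemma tensor_closed:
  assumes "\<alpha> \<in> carrier (\<D> n)" "\<beta> \<in> carrier (\<D> n)"
  shows "tensor (\<D> n) (\<D> n) \<alpha> \<beta> \<in> carrier (\<D>\<D> n)"
  using assms unfolding tensor_group_def tensor_def carrier_FactGroup by auto

lemma tensor_pairing_hom:
  "(\<lambda>T. tensor_pairing T f g) \<in> hom (\<D>\<D> n) integer_group"
proof (rule homI)
  let ?F = "free_Abelian_group (carrier (\<D> n) \<times> carrier (\<D> n))"
  let ?N = "tensor_kernel (\<D> n) (\<D> n)"
  show "tensor_pairing T f g \<in> carrier integer_group" for T
    by simp
  fix S T assume "S \<in> carrier (\<D>\<D> n)" "T \<in> carrier (\<D>\<D> n)"
  then obtain x y where xy: "x \<in> carrier ?F" "y \<in> carrier ?F"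
    and S: "S = ?N #>\<^bsub>?F\<^esub> x" and T: "T = ?N #>\<^bsub>?F\<^esub> y"
    unfolding tensor_group_def carrier_FactGroup by blast
  have "S \<otimes>\<^bsub>\<D>\<D> n\<^esub> T = ?N #>\<^bsub>?F\<^esub> (x + y)"
    using normal.rcos_sum[OF tensor_kernel_normal[OF group_dual_group group_dual_group] xy]
    by (simp add: S T tensor_group_def)
  then show "tensor_pairing (S \<otimes>\<^bsub>\<D>\<D> n\<^esub> T) f g
      = tensor_pairing S f g \<otimes>\<^bsub>integer_group\<^esub> tensor_pairing T f g"
    by (simp add: S T tensor_pairing_coset int_extend_add)
qed

lemma tensor_pairing_finprod:
  assumes "finite A" "t \<in> A \<rightarrow> carrier (\<D>\<D> n)"
  shows "tensor_pairing (finprod (\<D>\<D> n) t A) f g = (\<Sum>k\<in>A. tensor_pairing (t k) f g)"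
proof -
  interpret T: comm_group "\<D>\<D> n"
    by (simp add: comm_group_tensor_group)
  interpret h: group_hom "\<D>\<D> n" integer_group "\<lambda>T. tensor_pairing T f g"
    by (simp add: group_hom_def group_hom_axioms_def tensor_pairing_hom T.is_group)
  from assms show ?thesis
  proof (induction A)
    case empty
    then show ?case using h.hom_one by simp
  next
    case (insert a A)
    then have "t \<in> A \<rightarrow> carrier (\<D>\<D> n)" "t a \<in> carrier (\<D>\<D> n)"
      by auto
    then show ?case
      using insert h.hom_mult[of "t a" "finprod (\<D>\<D> n) t A"] by simp
  qed
qed

lemma finite_pairs_add_eq: "finite {(a, b). a \<in> weak_comps n \<and> b \<in> weak_comps n \<and> a + b = c}"
proof -
  let ?A = "{a. \<forall>i. Poly_Mapping.lookup a i \<le> Poly_Mapping.lookup c i}"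
  let ?m = "Max (Poly_Mapping.lookup c ` Poly_Mapping.keys c)"
  let ?B = "{f. \<forall>i. (i \<in> Poly_Mapping.keys c \<longrightarrow> f i \<in> {..?m})
          \<and> (i \<notin> Poly_Mapping.keys c \<longrightarrow> f i = 0)}"
  have "Poly_Mapping.lookup a \<in> ?B" if a: "a \<in> ?A" for a
  proof (intro CollectI allI conjI impI)
    fix i
    have le: "Poly_Mapping.lookup a i \<le> Poly_Mapping.lookup c i"
      using a by simp
    show "Poly_Mapping.lookup a i \<in> {..?m}" if "i \<in> Poly_Mapping.keys c"
      using le that by (auto intro!: order.trans[OF le] Max_ge)
    show "Poly_Mapping.lookup a i = 0" if "i \<notin> Poly_Mapping.keys c"
      using le that by (simp add: in_keys_iff)
  qed
  then have "Poly_Mapping.lookup ` ?A \<subseteq> ?B"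
    by (rule image_subsetI)
  moreover have "finite ?B"
    by (rule finite_set_of_finite_funs) simp_all
  ultimately have "finite (Poly_Mapping.lookup ` ?A)"
    by (rule finite_subset)
  then have "finite ?A"
    by (rule finite_imageD) (simp add: inj_on_def)
  moreover have "{(a, b). a \<in> weak_comps n \<and> b \<in> weak_comps n \<and> a + b = c} \<subseteq> ?A \<times> ?A"
    by (auto simp: lookup_add)
  ultimately show ?thesis
    by (meson finite_SigmaI finite_subset)
qed

lemma lookup_times_weak_comps:
  fixes f g :: mpoly
  assumes "c \<in> weak_comps n"
  shows "Poly_Mapping.lookup (f * g) c =
    (\<Sum>(a, b)\<in>{(a, b). a \<in> weak_comps n \<and> b \<in> weak_comps n \<and> a + b = c}.
        Poly_Mapping.lookup f a * Poly_Mapping.lookup g b)"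
proof -
  let ?P = "{(a, b). a \<in> weak_comps n \<and> b \<in> weak_comps n \<and> a + b = c}"
  have P: "(a, b) \<in> ?P" if "a + b = c" for a b
    using assms that by (auto simp: weak_comps_def in_keys_iff lookup_add subset_iff)
  have "Poly_Mapping.lookup (f * g) c
      = prod_fun (Poly_Mapping.lookup f) (Poly_Mapping.lookup g) c"
    by (simp add: times_poly_mapping.rep_eq)
  also have "\<dots> = (\<Sum>(a, b). Poly_Mapping.lookup f a * Poly_Mapping.lookup g b when c = a + b)"
    by (rule prod_fun_unfold_prod) auto
  also have "\<dots> = (\<Sum>(a, b)\<in>?P. Poly_Mapping.lookup f a * Poly_Mapping.lookup g b when c = a + b)"
  proof (rule Sum_any.expand_superset[OF finite_pairs_add_eq])
    show "{p. (case p of (a, b) \<Rightarrow> Poly_Mapping.lookup f a * Poly_Mapping.lookup g b when c = a + b) \<noteq> 0} \<subseteq> ?P"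
    proof (rule subsetI)
      fix p assume "p \<in> {p. (case p of (a, b) \<Rightarrow> Poly_Mapping.lookup f a * Poly_Mapping.lookup g b when c = a + b) \<noteq> 0}"
      then have "fst p + snd p = c"
        by (cases p) (auto simp: when_def split: if_splits)
      from P[OF this] show "p \<in> ?P"
        by simp
    qed
  qed
  also have "\<dots> = (\<Sum>(a, b)\<in>?P. Poly_Mapping.lookup f a * Poly_Mapping.lookup g b)"
    by (rule sum.cong) (auto simp: when_def)
  finally show ?thesis .
qed

lemma tensor_pairing_coproduct:
  assumes "\<alpha> \<in> carrier (\<D> n)"
  shows "tensor_pairing (coproduct n \<alpha>) f g = pairing \<alpha> (f * g)"
proof -
  interpret T: comm_group "\<D>\<D> n"
    by (simp add: comm_group_tensor_group)
  interpret h: group_hom "\<D>\<D> n" integer_group "\<lambda>T. tensor_pairing T f g"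
    by (simp add: group_hom_def group_hom_axioms_def tensor_pairing_hom T.is_group)
  let ?P = "\<lambda>c. {(a, b). a \<in> weak_comps n \<and> b \<in> weak_comps n \<and> a + b = c}"
  let ?t = "\<lambda>(a, b). tensor (\<D> n) (\<D> n) (frag_of a) (frag_of b)"
  have t: "?t \<in> ?P c \<rightarrow> carrier (\<D>\<D> n)" for c
    by (auto intro!: tensor_closed) (simp_all add: dual_group_def)
  have fin: "finprod (\<D>\<D> n) ?t (?P c) \<in> carrier (\<D>\<D> n)" for c
    by (rule T.finprod_closed[OF t])
  have *: "tensor_pairing (finprod (\<D>\<D> n) ?t (?P c)) f g = Poly_Mapping.lookup (f * g) c"
    if "c \<in> Poly_Mapping.keys \<alpha>" for c
  proof -
    have "c \<in> weak_comps n"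
      using assms that by (auto simp: dual_group_def)
    then show ?thesis
      by (simp add: tensor_pairing_finprod[OF finite_pairs_add_eq t] lookup_times_weak_comps
          tensor_pairing_tensor case_prod_beta)
  qed
  have "tensor_pairing (coproduct n \<alpha>) f g = (\<Sum>c\<in>Poly_Mapping.keys \<alpha>.
      tensor_pairing (finprod (\<D>\<D> n) ?t (?P c) [^]\<^bsub>\<D>\<D> n\<^esub> Poly_Mapping.lookup \<alpha> c) f g)"
    unfolding coproduct_def
    by (rule tensor_pairing_finprod) (use fin in auto)
  also have "\<dots> = pairing \<alpha> (f * g)"
    unfolding pairing_def
    by (rule sum.cong) (simp_all add: h.hom_int_pow[OF fin] *)
  finally show ?thesis .
qed

end

theory Submission
  imports Defs
begin

text \<open>
  The coproduct is dual to multiplication of polynomials and \<open>\<Xi>\<^sub>u\<close> is dual to \<open>\<SS>\<^sub>u\<close>. Hence both sides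
  of the theorem, paired with \<open>\<SS>\<^sub>u \<otimes> \<SS>\<^sub>v\<close>, give the coefficient of \<open>\<SS>\<^sub>w\<close> in \<open>\<SS>\<^sub>u \<SS>\<^sub>v\<close>, and they agree
  because an element of \<open>\<D>\<^sub>n \<otimes> \<D>\<^sub>n\<close> is determined by its pairings
  (\<open>tensor_pairing_nondegenerate\<close>). This argument needs the classical fact that Schubert polynomials
  are well defined and that those with last descent at most \<open>n\<close> form a basis of
  \<open>\<int>[x\<^sub>1, \<dots>, x\<^sub>n]\<close>.

  That fact is obtained from explicit dual functionals. For \<open>w \<in> S\<^sub>\<infinity>\<close> let \<open>\<epsilon>\<^sub>w f\<close> be the constant term
  of \<open>\<partial>\<^sub>w f\<close>, the result of applying divided differences along a chain of descents from \<open>w\<close> to the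
  identity. By the commutation and braid relations \<open>\<epsilon>\<^sub>w\<close> does not depend on the chain
  (\<open>schubert_functional_descent\<close>). The functionals separate polynomials
  (\<open>schubert_functionals_separate\<close>): if they all vanish on \<open>f\<close>, they vanish on each \<open>\<partial>\<^sub>i f\<close>, so by
  induction on the degree \<open>f\<close> is symmetric in all variables, hence constant, hence zero.

  A direct computation gives \<open>\<epsilon>\<^sub>v\<close> of the staircase monomial \<open>x\<^sub>1\<^bsup>m-1\<^esup> x\<^sub>2\<^bsup>m-2\<^esup> \<cdots>\<close> as \<open>1\<close> if \<open>v\<close> is the longest
  permutation of \<open>S\<^sub>m\<close> and \<open>0\<close> otherwise (\<open>schubert_functional_staircase\<close>). Going down along descents,
  every polynomial \<open>f\<close> reached at \<open>w\<close> satisfies \<open>\<epsilon>\<^sub>v f = \<delta>\<^sub>v\<^sub>,\<^sub>w\<close> (\<open>is_schubert_functional\<close>). By separation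
  \<open>f\<close> depends on \<open>w\<close> only, and every \<open>f\<close> equals \<open>\<Sum>\<^sub>v \<epsilon>\<^sub>v(f) \<SS>\<^sub>v\<close> (\<open>schubert_expansion\<close>). Consequently
  \<open>c\<^sup>w\<^sub>u\<^sub>,\<^sub>v = \<epsilon>\<^sub>w(\<SS>\<^sub>u \<SS>\<^sub>v)\<close> (\<open>schubert_coeff_eq_functional\<close>), and pairing with \<open>\<Xi>\<^sub>w\<close> is \<open>\<epsilon>\<^sub>w\<close> (\<open>dual_schubert\<close>).
  The finiteness statements come from degrees: \<open>\<epsilon>\<^sub>w\<close> only sees polynomials of degree the length of \<open>w\<close>.
\<close>



section \<open>Polynomials and divided differences\<close>

abbreviation monom :: "expvec \<Rightarrow> int \<Rightarrow> mpoly" where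
  "monom \<equiv> Poly_Mapping.single"

abbreviation coeff :: "mpoly \<Rightarrow> expvec \<Rightarrow> int" where
  "coeff \<equiv> Poly_Mapping.lookup"

definition total_degree :: "expvec \<Rightarrow> nat" where
  "total_degree a = (\<Sum>i. Poly_Mapping.lookup a i)"

abbreviation swap_exps :: "nat \<Rightarrow> expvec \<Rightarrow> expvec" where
  "swap_exps i \<equiv> Poly_Mapping.map_key (transpose i (Suc i))"

lemma total_degree_add: "total_degree (a + b) = total_degree a + total_degree b"
  unfolding total_degree_def lookup_add by (rule Sum_any.distrib) simp_all

lemma total_degree_zero [simp]: "total_degree 0 = 0"
  by (simp add: total_degree_def)

lemma total_degree_single [simp]: "total_degree (Poly_Mapping.single i k) = k"
  by (simp add: total_degree_def lookup_single)

lemma lookup_le_total_degree: "Poly_Mapping.lookup a i \<le> total_degree a"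
proof -
  have "total_degree a = (\<Sum>j\<in>insert i (Poly_Mapping.keys a). Poly_Mapping.lookup a j)"
    unfolding total_degree_def by (rule Sum_any.expand_superset) (auto simp: in_keys_iff)
  then show ?thesis
    by (simp add: member_le_sum)
qed

lemma lookup_swap_exps [simp]:
  "Poly_Mapping.lookup (swap_exps i a) j = Poly_Mapping.lookup a (transpose i (Suc i) j)"
  by (simp add: map_key.rep_eq[OF inj_transpose])

lemma swap_exps_involutory [simp]: "swap_exps i (swap_exps i a) = a"
  by (rule poly_mapping_eqI) simp

lemma inj_swap_exps: "inj (swap_exps i)"
  by (rule inj_on_inverseI[where g = "swap_exps i"]) simp

lemma lookup_swap_vars [simp]: "coeff (swap_vars i f) a = coeff f (swap_exps i a)"
  by (simp add: swap_vars_def map_key.rep_eq[OF inj_swap_exps])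

lemma swap_vars_involutory [simp]: "swap_vars i (swap_vars i f) = f"
  by (rule poly_mapping_eqI) simp

lemma swap_vars_zero [simp]: "swap_vars i 0 = 0"
  by (rule poly_mapping_eqI) simp

lemma swap_vars_add [simp]: "swap_vars i (f + g) = swap_vars i f + swap_vars i g"
  by (rule poly_mapping_eqI) (simp add: lookup_add)

lemma swap_vars_minus [simp]: "swap_vars i (- f) = - swap_vars i f"
  by (rule poly_mapping_eqI) simp

lemma swap_vars_diff [simp]: "swap_vars i (f - g) = swap_vars i f - swap_vars i g"
  by (rule poly_mapping_eqI) (simp add: lookup_minus)

lemma swap_vars_sum: "swap_vars i (sum h A) = (\<Sum>x\<in>A. swap_vars i (h x))"
  by (induction A rule: infinite_finite_induct) auto

lemma swap_vars_monom [simp]: "swap_vars i (monom a c) = monom (swap_exps i a) c"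
proof (rule poly_mapping_eqI)
  fix b
  have "a = swap_exps i b \<longleftrightarrow> swap_exps i a = b"
    by (metis swap_exps_involutory)
  then show "coeff (swap_vars i (monom a c)) b = coeff (monom (swap_exps i a) c) b"
    by (simp add: lookup_single when_def)
qed

lemma poly_eq_sum_monom: "f = (\<Sum>a\<in>Poly_Mapping.keys f. monom a (coeff f a))"
  for f :: mpoly
proof (rule poly_mapping_eqI)
  fix b
  have "coeff (\<Sum>a\<in>Poly_Mapping.keys f. monom a (coeff f a)) b
      = (\<Sum>a\<in>Poly_Mapping.keys f. if a = b then coeff f a else 0)"
    by (simp add: lookup_sum lookup_single when_def)
  also have "\<dots> = coeff f b"
    by (simp add: in_keys_iff)
  finally show "coeff f b = coeff (\<Sum>a\<in>Poly_Mapping.keys f. monom a (coeff f a)) b"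
    by simp
qed

lemma swap_exps_add: "swap_exps i (a + b) = swap_exps i a + swap_exps i b"
  by (rule poly_mapping_eqI) (simp add: lookup_add)

lemma swap_vars_mult [simp]: "swap_vars i (f * g) = swap_vars i f * swap_vars i g"
proof -
  let ?F = "Poly_Mapping.keys f" and ?G = "Poly_Mapping.keys g"
  have "swap_vars i (f * g) = swap_vars i ((\<Sum>a\<in>?F. monom a (coeff f a)) * (\<Sum>b\<in>?G. monom b (coeff g b)))"
    by (simp only: poly_eq_sum_monom[symmetric])
  also have "\<dots> = (\<Sum>a\<in>?F. swap_vars i (monom a (coeff f a))) * (\<Sum>b\<in>?G. swap_vars i (monom b (coeff g b)))"
    by (simp add: sum_product swap_vars_sum mult_single swap_exps_add)
  also have "\<dots> = swap_vars i f * swap_vars i g"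
    by (simp only: swap_vars_sum[symmetric] poly_eq_sum_monom[symmetric])
  finally show ?thesis .
qed

lemma swap_vars_one [simp]: "swap_vars i 1 = 1"
proof -
  have "swap_exps i 0 = 0"
    by (rule poly_mapping_eqI) simp
  then show ?thesis
    using swap_vars_monom[of i 0 1] by simp
qed

lemma swap_vars_of_int [simp]: "swap_vars i (of_int c) = of_int c"
  by (metis add.commute add.right_neutral map_key_zero inj_transpose single_of_int swap_vars_monom)

lemma swap_vars_power [simp]: "swap_vars i (f ^ k) = swap_vars i f ^ k"
  by (induction k) auto

lemma swap_vars_prod: "swap_vars i (prod h A) = (\<Prod>x\<in>A. swap_vars i (h x))"
  by (induction A rule: infinite_finite_induct) auto

lemma swap_vars_var [simp]: "swap_vars i (var j) = var (transpose i (Suc i) j)"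
proof -
  have "swap_exps i (Poly_Mapping.single j 1) = Poly_Mapping.single (transpose i (Suc i) j) 1"
    by (rule poly_mapping_eqI) (auto simp: lookup_single when_def transpose_def)
  then show ?thesis
    by (simp add: var_def)
qed

lemma var_inject [simp]: "var i = var j \<longleftrightarrow> i = j"
  unfolding var_def by (metis lookup_single_eq lookup_single_not_eq zero_neq_one)

text \<open>
  What is retained about the exponents \<open>a\<close> of \<open>\<partial>\<^sub>i x\<^sup>b\<close>. The bound by the maximum is what makes divided
  differences preserve the monomials below a staircase; the drop in degree is what relates degree
  and length.
\<close>

definition div_diff_exponent :: "nat \<Rightarrow> expvec \<Rightarrow> expvec \<Rightarrow> bool" where
  "div_diff_exponent i b a \<longleftrightarrow>
     (\<forall>j. j \<noteq> i \<longrightarrow> j \<noteq> Suc i \<longrightarrow> Poly_Mapping.lookup a j = Poly_Mapping.lookup b j) \<and>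
     Suc (total_degree a) = total_degree b \<and>
     Poly_Mapping.lookup a i < max (Poly_Mapping.lookup b i) (Poly_Mapping.lookup b (Suc i)) \<and>
     Poly_Mapping.lookup a (Suc i) < max (Poly_Mapping.lookup b i) (Poly_Mapping.lookup b (Suc i))"

text \<open>
  For \<open>p = b\<^sub>i \<ge> q = b\<^sub>i\<^sub>+\<^sub>1\<close> the quotient is \<open>\<Sum>\<^bsub>k<p-q\<^esub> x\<^sub>i\<^bsup>q+k\<^esup> x\<^sub>i\<^sub>+\<^sub>1\<^bsup>p-1-k\<^esup>\<close> times the other variables: multiplied
  by \<open>x\<^sub>i - x\<^sub>i\<^sub>+\<^sub>1\<close> it telescopes. The opposite case follows by exchanging the two variables.
\<close>

lemma div_diff_monom_aux:
  assumes "Poly_Mapping.lookup b (Suc i) \<le> Poly_Mapping.lookup b i"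
  shows "\<exists>g. (var i - var (Suc i)) * g = monom b c - swap_vars i (monom b c) \<and>
    (\<forall>a\<in>Poly_Mapping.keys g. div_diff_exponent i b a)"
proof -
  let ?p = "Poly_Mapping.lookup b i" and ?q = "Poly_Mapping.lookup b (Suc i)"
  define r where "r = Poly_Mapping.update i 0 (Poly_Mapping.update (Suc i) 0 b)"
  define e where "e s t = r + Poly_Mapping.single i s + Poly_Mapping.single (Suc i) t" for s t :: nat
  have lookup_e: "Poly_Mapping.lookup (e s t) j
      = (if j = i then s else if j = Suc i then t else Poly_Mapping.lookup b j)" for s t j
    by (auto simp: e_def r_def lookup_add lookup_single lookup_update when_def)
  have b: "b = e ?p ?q" and sb: "swap_exps i b = e ?q ?p"
    by (rule poly_mapping_eqI, auto simp: lookup_e transpose_def)+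
  define h where "h k = e (?q + k) (?p - 1 - k)" for k
  define g where "g = (\<Sum>k<?p - ?q. monom (h k) c)"
  have step: "(var i - var (Suc i)) * monom (h k) c
      = monom (e (?q + Suc k) (?p - Suc k)) c - monom (e (?q + k) (?p - k)) c"
    if "k < ?p - ?q" for k
  proof -
    have 1: "Poly_Mapping.single i 1 + h k = e (?q + Suc k) (?p - Suc k)"
      by (rule poly_mapping_eqI) (auto simp: lookup_e h_def lookup_add lookup_single when_def)
    have 2: "Poly_Mapping.single (Suc i) 1 + h k = e (?q + k) (?p - k)"
      using that by (intro poly_mapping_eqI) (auto simp: lookup_e h_def lookup_add lookup_single when_def)
    show ?thesis
      unfolding var_def left_diff_distrib mult_single 1 2 by simp
  qed
  have "(var i - var (Suc i)) * g
      = (\<Sum>k<?p - ?q. monom (e (?q + Suc k) (?p - Suc k)) c - monom (e (?q + k) (?p - k)) c)"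
    unfolding g_def sum_distrib_left by (rule sum.cong) (use step in auto)
  also have "\<dots> = monom (e (?q + (?p - ?q)) (?p - (?p - ?q))) c - monom (e ?q ?p) c"
    by (subst sum_lessThan_telescope) simp
  also have "\<dots> = monom b c - swap_vars i (monom b c)"
    using assms b sb by simp
  finally have g: "(var i - var (Suc i)) * g = monom b c - swap_vars i (monom b c)" .
  have "div_diff_exponent i b a" if a: "a \<in> Poly_Mapping.keys g" for a
  proof -
    obtain k where k: "k < ?p - ?q" "a = h k"
      using a keys_sum[of "\<lambda>k. monom (h k) c" "{..<?p - ?q}"] unfolding g_def
      by (auto split: if_splits)
    have "total_degree b = total_degree (e ?p ?q)"
      using b by simp
    then have "Suc (total_degree a) = total_degree b"
      using k by (simp add: h_def e_def total_degree_add)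
    then show ?thesis
      using k assms by (auto simp: div_diff_exponent_def h_def lookup_e)
  qed
  with g show ?thesis by blast
qed

lemma div_diff_monom_exists:
  "\<exists>g. (var i - var (Suc i)) * g = monom b c - swap_vars i (monom b c) \<and>
    (\<forall>a\<in>Poly_Mapping.keys g. div_diff_exponent i b a)"
proof (cases "Poly_Mapping.lookup b (Suc i) \<le> Poly_Mapping.lookup b i")
  case True
  then show ?thesis by (rule div_diff_monom_aux)
next
  case False
  let ?b = "swap_exps i b"
  obtain g where g: "(var i - var (Suc i)) * g = monom ?b c - swap_vars i (monom ?b c)"
    and keys: "\<forall>a\<in>Poly_Mapping.keys g. div_diff_exponent i ?b a"
    using div_diff_monom_aux[of ?b i c] False by auto
  have "total_degree ?b = total_degree b"
    unfolding total_degree_def lookup_swap_exps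
    by (rule Sum_any.reindex_cong[OF bij_transpose[of i "Suc i"], symmetric]) (simp add: fun_eq_iff)
  then have "div_diff_exponent i ?b a \<longleftrightarrow> div_diff_exponent i b a" for a
    by (auto simp: div_diff_exponent_def transpose_def max.commute)
  then show ?thesis
    using g keys by (intro exI[of _ "- g"]) auto
qed

lemma div_diff_exists:
  "\<exists>g. (var i - var (Suc i)) * g = f - swap_vars i f \<and>
    (\<forall>a\<in>Poly_Mapping.keys g. \<exists>b\<in>Poly_Mapping.keys f. div_diff_exponent i b a)"
proof -
  let ?F = "Poly_Mapping.keys f"
  obtain G where G: "\<And>b. (var i - var (Suc i)) * G b = monom b (coeff f b) - swap_vars i (monom b (coeff f b))"
    and keys: "\<And>b a. a \<in> Poly_Mapping.keys (G b) \<Longrightarrow> div_diff_exponent i b a"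
    using choice[of "\<lambda>b g. (var i - var (Suc i)) * g = monom b (coeff f b) - swap_vars i (monom b (coeff f b)) \<and>
      (\<forall>a\<in>Poly_Mapping.keys g. div_diff_exponent i b a)"] div_diff_monom_exists[of i _ "coeff f _"]
    by blast
  have "(var i - var (Suc i)) * sum G ?F
      = (\<Sum>b\<in>?F. monom b (coeff f b)) - swap_vars i (\<Sum>b\<in>?F. monom b (coeff f b))"
    by (simp only: sum_distrib_left G sum_subtractf swap_vars_sum)
  also have "\<dots> = f - swap_vars i f"
    using poly_eq_sum_monom[of f] by simp
  finally show ?thesis
    using keys keys_sum[of G ?F] by blast
qed

lemma var_diff_mult_cancel:
  "(var i - var j) * f = (var i - var j) * g \<longleftrightarrow> i = j \<or> f = g"
  by simp

lemma div_diff_eqI: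
  assumes "(var i - var (Suc i)) * g = f - swap_vars i f"
  shows "div_diff i f = g"
  unfolding div_diff_def
proof (rule the_equality)
  show "h = g" if "(var i - var (Suc i)) * h = f - swap_vars i f" for h
    using that assms by (metis var_diff_mult_cancel n_not_Suc_n)
qed (fact assms)

lemma var_diff_mult_div_diff: "(var i - var (Suc i)) * div_diff i f = f - swap_vars i f"
  using div_diff_exists[of i f] div_diff_eqI by blast

lemma keys_div_diff:
  assumes "a \<in> Poly_Mapping.keys (div_diff i f)"
  obtains b where "b \<in> Poly_Mapping.keys f" "div_diff_exponent i b a"
  using assms div_diff_exists[of i f] div_diff_eqI by metis

lemma div_diff_eq_0_iff: "div_diff i f = 0 \<longleftrightarrow> swap_vars i f = f"
  using var_diff_mult_div_diff[of i f]
  by (metis div_diff_eqI eq_iff_diff_eq_0 mult_zero_right)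

lemma div_diff_zero [simp]: "div_diff i 0 = 0"
  by (simp add: div_diff_eq_0_iff)

lemma div_diff_add: "div_diff i (f + g) = div_diff i f + div_diff i g"
  by (rule div_diff_eqI) (simp add: distrib_left var_diff_mult_div_diff)

lemma div_diff_mult_symmetric:
  assumes "swap_vars i g = g"
  shows "div_diff i (g * f) = g * div_diff i f"
proof (rule div_diff_eqI)
  have "(var i - var (Suc i)) * (g * div_diff i f) = g * ((var i - var (Suc i)) * div_diff i f)"
    by (simp add: mult.left_commute)
  then show "(var i - var (Suc i)) * (g * div_diff i f) = g * f - swap_vars i (g * f)"
    using assms by (simp add: var_diff_mult_div_diff right_diff_distrib)
qed

lemma div_diff_of_int_mult: "div_diff i (of_int c * f) = of_int c * div_diff i f"
  by (simp add: div_diff_mult_symmetric)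

lemma swap_vars_div_diff [simp]: "swap_vars i (div_diff i f) = div_diff i f"
proof -
  have "(var i - var (Suc i)) * swap_vars i (div_diff i f)
      = - swap_vars i ((var i - var (Suc i)) * div_diff i f)"
    by (simp add: algebra_simps)
  also have "\<dots> = (var i - var (Suc i)) * div_diff i f"
    unfolding var_diff_mult_div_diff by simp
  finally show ?thesis
    by (metis var_diff_mult_cancel n_not_Suc_n)
qed

lemma div_diff_div_diff [simp]: "div_diff i (div_diff i f) = 0"
  by (simp add: div_diff_eq_0_iff)

lemma swap_vars_commute:
  assumes "Suc i < j"
  shows "swap_vars i (swap_vars j f) = swap_vars j (swap_vars i f)"
proof (rule poly_mapping_eqI)
  fix a
  have "swap_exps j (swap_exps i a) = swap_exps i (swap_exps j a)"
    using assms by (intro poly_mapping_eqI) (auto simp: transpose_def)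
  then show "coeff (swap_vars i (swap_vars j f)) a = coeff (swap_vars j (swap_vars i f)) a"
    by simp
qed

lemma swap_vars_braid:
  "swap_vars (Suc i) (swap_vars i (swap_vars (Suc i) f)) = swap_vars i (swap_vars (Suc i) (swap_vars i f))"
proof (rule poly_mapping_eqI)
  fix a
  have "swap_exps (Suc i) (swap_exps i (swap_exps (Suc i) a)) = swap_exps i (swap_exps (Suc i) (swap_exps i a))"
    by (intro poly_mapping_eqI) (auto simp: transpose_def)
  then show "coeff (swap_vars (Suc i) (swap_vars i (swap_vars (Suc i) f))) a
      = coeff (swap_vars i (swap_vars (Suc i) (swap_vars i f))) a"
    by simp
qed

text \<open>Each of the two denominators is symmetric for the other transposition, so both can be cleared.\<close>

lemma div_diff_commute:
  assumes "Suc i < j"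
  shows "div_diff i (div_diff j f) = div_diff j (div_diff i f)"
proof -
  let ?x = "var i - var (Suc i)" and ?y = "var j - var (Suc j)"
  have inv: "swap_vars i ?y = ?y" "swap_vars j ?x = ?x"
    using assms by (auto simp: transpose_def)
  have "?x * (?y * div_diff i (div_diff j f)) = ?x * div_diff i (?y * div_diff j f)"
    by (simp only: div_diff_mult_symmetric[OF inv(1)])
  also have "\<dots> = (f - swap_vars j f) - swap_vars i (f - swap_vars j f)"
    by (simp only: var_diff_mult_div_diff)
  also have "\<dots> = (f - swap_vars i f) - swap_vars j (f - swap_vars i f)"
    by (simp add: swap_vars_commute[OF assms])
  also have "\<dots> = ?y * div_diff j (?x * div_diff i f)"
    by (simp only: var_diff_mult_div_diff)
  also have "\<dots> = ?x * (?y * div_diff j (div_diff i f))"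
    by (simp only: div_diff_mult_symmetric[OF inv(2)] mult.left_commute)
  finally show ?thesis
    by (metis var_diff_mult_cancel n_not_Suc_n)
qed

text \<open>
  Both sides are the antisymmetrisation of \<open>f\<close> over the permutations of three neighbouring
  variables, divided by their Vandermonde product.
\<close>

lemma div_diff_braid:
  "div_diff i (div_diff (Suc i) (div_diff i f)) = div_diff (Suc i) (div_diff i (div_diff (Suc i) f))"
proof -
  define x y z where xyz: "x = var i" "y = var (Suc i)" "z = var (Suc (Suc i))"
  define s1 s2 where s: "s1 = swap_vars i" "s2 = swap_vars (Suc i)"
  have [simp]: "s1 x = y" "s1 y = x" "s1 z = z" "s2 x = x" "s2 y = z" "s2 z = y"
    by (simp_all add: xyz s transpose_def)
  have [simp]: "s1 (p - q) = s1 p - s1 q" "s1 (p * q) = s1 p * s1 q"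
    "s2 (p - q) = s2 p - s2 q" "s2 (p * q) = s2 p * s2 q" for p q
    by (simp_all add: s)
  have d1: "(x - y) * div_diff i p = p - s1 p" and d2: "(y - z) * div_diff (Suc i) p = p - s2 p" for p
    by (simp_all add: xyz s var_diff_mult_div_diff)
  have braid: "s2 (s1 (s2 f)) = s1 (s2 (s1 f))"
    by (simp add: s swap_vars_braid)
  define A where "A = f - s1 f - s2 f + s1 (s2 f) + s2 (s1 f) - s1 (s2 (s1 f))"
  have nz: "x - y \<noteq> 0" "y - z \<noteq> 0" "x - z \<noteq> 0"
    by (simp_all add: xyz)
  define g where "g = div_diff i f"
  define h where "h = div_diff (Suc i) g"
  define k where "k = div_diff i h"
  have g: "(x - y) * g = f - s1 f" and h: "(y - z) * h = g - s2 g" and k: "(x - y) * k = h - s1 h"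
    by (simp_all add: g_def h_def k_def d1 d2)
  have s1g: "s1 g = g"
    by (simp add: g_def s)
  have 1: "(x - z) * s2 g = s2 f - s2 (s1 f)"
    using arg_cong[OF g, of s2] by simp
  have 2: "(x - z) * s1 h = g - s1 (s2 g)"
    using arg_cong[OF h, of s1] s1g by simp
  have 3: "(y - z) * s1 (s2 g) = s1 (s2 f) - s1 (s2 (s1 f))"
    using arg_cong[OF 1, of s1] by simp
  have "(x - y) * ((x - y) * (x - z) * (y - z) * k) = (x - y) * A"
    using g h k 1 2 3 unfolding A_def by algebra
  then have k': "(x - y) * (x - z) * (y - z) * k = A"
    using nz by simp
  define g' where "g' = div_diff (Suc i) f"
  define h' where "h' = div_diff i g'"
  define l where "l = div_diff (Suc i) h'"
  have g': "(y - z) * g' = f - s2 f" and h': "(x - y) * h' = g' - s1 g'" and l: "(y - z) * l = h' - s2 h'"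
    by (simp_all add: g'_def h'_def l_def d1 d2)
  have s2g': "s2 g' = g'"
    by (simp add: g'_def s)
  have 4: "(x - z) * s1 g' = s1 f - s1 (s2 f)"
    using arg_cong[OF g', of s1] by simp
  have 5: "(x - z) * s2 h' = g' - s2 (s1 g')"
    using arg_cong[OF h', of s2] s2g' by simp
  have 6: "(x - y) * s2 (s1 g') = s2 (s1 f) - s1 (s2 (s1 f))"
    using arg_cong[OF 4, of s2] braid by simp
  have "(y - z) * ((x - y) * (x - z) * (y - z) * l) = (y - z) * A"
    using g' h' l 4 5 6 unfolding A_def by algebra
  then have "(x - y) * (x - z) * (y - z) * l = (x - y) * (x - z) * (y - z) * k"
    using nz k' by simp
  then have "l = k"
    using nz by simp
  then show ?thesis
    by (simp add: k_def h_def g_def l_def h'_def g'_def)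
qed


section \<open>Descents and length of a permutation\<close>

abbreviation adj_transp :: "nat \<Rightarrow> nat \<Rightarrow> nat" where
  "adj_transp i \<equiv> transpose i (Suc i)"

definition is_descent :: "(nat \<Rightarrow> nat) \<Rightarrow> nat \<Rightarrow> bool" where
  "is_descent w i \<longleftrightarrow> 1 \<le> i \<and> w (Suc i) < w i"

definition inversions :: "(nat \<Rightarrow> nat) \<Rightarrow> (nat \<times> nat) set" where
  "inversions w = {(i, j). 1 \<le> i \<and> i < j \<and> w j < w i}"

definition perm_length :: "(nat \<Rightarrow> nat) \<Rightarrow> nat" where
  "perm_length w = card (inversions w)"

lemma S_infI:
  assumes "w permutes {1..m}"
  shows "w \<in> S_inf"
proof -
  have "w permutes {1..}"
    by (rule permutes_subset[OF assms]) auto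
  moreover have "{i. w i \<noteq> i} \<subseteq> {1..m}"
    using permutes_not_in[OF assms] by blast
  ultimately show ?thesis
    unfolding S_inf_def using finite_subset by blast
qed

lemma S_inf_bounded:
  assumes "w \<in> S_inf"
  obtains m where "w permutes {1..m}"
proof
  let ?S = "{i. w i \<noteq> i}"
  have w: "w permutes {1..}" and fin: "finite ?S"
    using assms by (auto simp: S_inf_def)
  have "?S \<subseteq> {1..Max ?S}"
    using Max_ge[OF fin] permutes_not_in[OF w] by fastforce
  then have "w x = x" if "x \<notin> {1..Max ?S}" for x
    using that by blast
  with w show "w permutes {1..Max ?S}"
    unfolding permutes_def by blast
qed

lemma S_inf_inject: "w \<in> S_inf \<Longrightarrow> w i = w j \<longleftrightarrow> i = j"
  using permutes_inj[of w "{1..}"] inj_eq[of w i j] by (simp add: S_inf_def)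

lemma id_in_S_inf [simp]: "id \<in> S_inf"
  using S_infI[of id 0] by (simp add: permutes_id)

lemma comp_adj_transp_permutes:
  assumes "w permutes {1..m}" "1 \<le> i" "i < m"
  shows "w \<circ> adj_transp i permutes {1..m}"
  by (rule permutes_compose[OF permutes_swap_id assms(1)]) (use assms in auto)

lemma comp_adj_transp_in_S_inf:
  assumes "w \<in> S_inf" "1 \<le> i"
  shows "w \<circ> adj_transp i \<in> S_inf"
proof -
  obtain m where "w permutes {1..m}"
    using S_inf_bounded[OF assms(1)] .
  then have "w permutes {1..max m (Suc i)}"
    by (rule permutes_subset) auto
  then have "w \<circ> adj_transp i permutes {1..max m (Suc i)}"
    by (rule comp_adj_transp_permutes) (use assms in auto)
  then show ?thesis by (rule S_infI)
qed

lemma comp_adj_transp_cancel [simp]: "w \<circ> adj_transp i \<circ> adj_transp i = w"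
  by (simp add: fun_eq_iff)

lemma comp_adj_transp_eq_iff: "v \<circ> adj_transp i = w \<longleftrightarrow> v = w \<circ> adj_transp i"
  by (rule iffI, erule subst, simp only: comp_adj_transp_cancel, erule ssubst, rule comp_adj_transp_cancel)

lemma is_descent_comp_adj_transp:
  assumes "w \<in> S_inf" "1 \<le> i"
  shows "is_descent (w \<circ> adj_transp i) i \<longleftrightarrow> \<not> is_descent w i"
  using assms(2) S_inf_inject[OF assms(1), of i "Suc i"]
  unfolding is_descent_def o_def transpose_apply_first transpose_apply_second by linarith

lemma inversions_subset:
  assumes "w permutes {1..m}"
  shows "inversions w \<subseteq> {1..m} \<times> {1..m}"
proof clarify
  fix i j assume "(i, j) \<in> inversions w"
  then have ij: "1 \<le> i" "i < j" "w j < w i"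
    by (auto simp: inversions_def)
  have "j \<le> m"
  proof (rule ccontr)
    assume "\<not> j \<le> m"
    then have wj: "w j = j"
      using permutes_not_in[OF assms, of j] by simp
    then have "w i \<notin> {1..m}" "w i \<noteq> i"
      using ij \<open>\<not> j \<le> m\<close> by auto
    then show False
      using permutes_in_image[OF assms, of i] permutes_not_in[OF assms, of i] by metis
  qed
  then show "i \<in> {1..m} \<and> j \<in> {1..m}"
    using ij by simp
qed

lemma finite_inversions:
  assumes "w \<in> S_inf"
  shows "finite (inversions w)"
proof -
  obtain m where "w permutes {1..m}"
    using S_inf_bounded[OF assms] .
  then have "inversions w \<subseteq> {1..m} \<times> {1..m}"
    by (rule inversions_subset)
  then show ?thesis
    by (rule finite_subset) simp
qed

lemma perm_length_le:
  assumes "w permutes {1..m}"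
  shows "perm_length w \<le> m * m"
  unfolding perm_length_def
  using card_mono[OF _ inversions_subset[OF assms]] by (simp add: card_cartesian_product)

text \<open>
  Applying the transposition to both entries carries the inversions of \<open>w s\<^sub>i\<close> to those of \<open>w\<close>
  other than \<open>(i, i+1)\<close>, because no other pair of positions has its order reversed.
\<close>

lemma perm_length_descent:
  assumes "w \<in> S_inf" "is_descent w i"
  shows "perm_length w = Suc (perm_length (w \<circ> adj_transp i))"
proof -
  let ?t = "adj_transp i" and ?f = "\<lambda>(a, b). (adj_transp i a, adj_transp i b)"
  have i: "1 \<le> i" "w (Suc i) < w i"
    using assms by (auto simp: is_descent_def)
  have "inversions w - {(i, Suc i)} = ?f ` inversions (w \<circ> ?t)"
  proof (intro equalityI subsetI)
    fix p assume "p \<in> inversions w - {(i, Suc i)}"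
    then obtain a b where p: "p = (a, b)" "1 \<le> a" "a < b" "w b < w a" "\<not> (a = i \<and> b = Suc i)"
      by (auto simp: inversions_def)
    have "1 \<le> ?t a" "?t a < ?t b"
      using p i(1) by (auto simp: transpose_def)
    then have "?f p \<in> inversions (w \<circ> ?t)"
      using p by (simp add: inversions_def)
    moreover have "p = ?f (?f p)"
      by (cases p) simp
    ultimately show "p \<in> ?f ` inversions (w \<circ> ?t)"
      by blast
  next
    fix p assume "p \<in> ?f ` inversions (w \<circ> ?t)"
    then obtain a b where p: "p = (?t a, ?t b)" "1 \<le> a" "a < b" "w (?t b) < w (?t a)"
      by (auto simp: inversions_def)
    then have "\<not> (a = i \<and> b = Suc i)"
      using i(2) by auto
    then have "1 \<le> ?t a" "?t a < ?t b" "p \<noteq> (i, Suc i)"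
      using p i(1) by (auto simp: transpose_def)
    then show "p \<in> inversions w - {(i, Suc i)}"
      using p by (simp add: inversions_def)
  qed
  moreover have "inj_on ?f (inversions (w \<circ> ?t))"
    by (rule inj_on_inverseI[where g = ?f]) auto
  ultimately have "card (inversions w - {(i, Suc i)}) = perm_length (w \<circ> ?t)"
    by (simp add: card_image perm_length_def)
  moreover have "(i, Suc i) \<in> inversions w"
    using i by (simp add: inversions_def)
  ultimately show ?thesis
    using card_Suc_Diff1[OF finite_inversions[OF assms(1)]] by (metis perm_length_def)
qed

lemma perm_length_ascent:
  assumes "w \<in> S_inf" "1 \<le> i" "\<not> is_descent w i"
  shows "perm_length (w \<circ> adj_transp i) = Suc (perm_length w)"
  using perm_length_descent[OF comp_adj_transp_in_S_inf[OF assms(1,2)], of i]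
    is_descent_comp_adj_transp[OF assms(1,2)] assms(3) by simp

lemma perm_length_id [simp]: "perm_length id = 0"
  by (auto simp: perm_length_def inversions_def card_eq_0_iff)

text \<open>
  An increasing \<open>w\<close> gains at least \<open>i - 1\<close> up to \<open>i\<close> and at least \<open>m - i\<close> after it, which leaves no
  room for \<open>w i \<noteq> i\<close>. The decreasing case is handled in the same way for the longest permutation.
\<close>

lemma no_descent_imp_id:
  assumes "w \<in> S_inf" "\<And>i. \<not> is_descent w i"
  shows "w = id"
proof -
  obtain m where m: "w permutes {1..m}"
    using S_inf_bounded[OF assms(1)] .
  have up: "w i + k \<le> w (i + k)" if "1 \<le> i" for i k
  proof (induction k)
    case (Suc k)
    have "w (i + k) < w (Suc (i + k))"
      using assms(2)[of "i + k"] S_inf_inject[OF assms(1), of "i + k" "Suc (i + k)"] that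
      by (auto simp: is_descent_def)
    then show ?case using Suc by simp
  qed simp
  have "w i = i" if i: "i \<in> {1..m}" for i
  proof -
    have "1 \<le> w 1" "w m \<le> m"
      using i permutes_in_image[OF m, of 1] permutes_in_image[OF m, of m] by auto
    moreover have "w 1 + (i - 1) \<le> w i" "w i + (m - i) \<le> w m"
      using up[of 1 "i - 1"] up[of i "m - i"] i by auto
    ultimately show ?thesis
      using i by auto
  qed
  then show ?thesis
    using permutes_not_in[OF m] by (metis eq_id_iff)
qed

lemma exists_descent:
  assumes "w \<in> S_inf" "w \<noteq> id"
  obtains i where "is_descent w i"
  using assms no_descent_imp_id by blast

lemma finite_descents:
  assumes "w \<in> S_inf"
  shows "finite {i. is_descent w i}"
proof (rule finite_subset)
  show "{i. is_descent w i} \<subseteq> fst ` inversions w"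
    by (force simp: is_descent_def inversions_def)
qed (use finite_inversions[OF assms] in simp)

lemma maxd_eq: "maxd w = Max (insert 0 {i. is_descent w i})"
  by (simp add: maxd_def is_descent_def)

lemma descent_le_maxd:
  assumes "w \<in> S_inf" "is_descent w i"
  shows "i \<le> maxd w"
  unfolding maxd_eq using assms finite_descents by (intro Max_ge) auto

lemma is_descent_maxd:
  assumes "w \<in> S_inf" "0 < maxd w"
  shows "is_descent w (maxd w)"
  using Max_in[of "insert 0 {i. is_descent w i}"] finite_descents[OF assms(1)] assms(2)
  unfolding maxd_eq by auto

lemma longest_perm_permutes: "longest_perm m permutes {1..m}"
proof (rule bij_imp_permutes)
  show "bij_betw (longest_perm m) {1..m} {1..m}"
    by (rule bij_betwI[where g = "longest_perm m"]) (auto simp: longest_perm_def)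
qed (auto simp: longest_perm_def)

lemma all_descents_imp_longest:
  assumes m: "w permutes {1..m}" and desc: "\<And>i. 1 \<le> i \<Longrightarrow> i < m \<Longrightarrow> is_descent w i"
  shows "w = longest_perm m"
proof
  fix i
  have down: "w (i + k) + k \<le> w i" if "1 \<le> i" "i + k \<le> m" for i k
    using that(2)
  proof (induction k)
    case (Suc k)
    then have "w (Suc (i + k)) < w (i + k)"
      using desc[of "i + k"] that(1) by (auto simp: is_descent_def)
    then show ?case using Suc by simp
  qed simp
  show "w i = longest_perm m i"
  proof (cases "i \<in> {1..m}")
    case True
    have "w 1 \<le> m" "1 \<le> w m"
      using True permutes_in_image[OF m, of 1] permutes_in_image[OF m, of m] by auto
    moreover have "w i + (i - 1) \<le> w 1" "w m + (m - i) \<le> w i"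
      using down[of 1 "i - 1"] down[of i "m - i"] True by auto
    ultimately have "w i = m + 1 - i"
      using True by auto
    then show ?thesis
      using True by (simp add: longest_perm_def)
  next
    case False
    then show ?thesis
      using permutes_not_in[OF m] by (auto simp: longest_perm_def)
  qed
qed

text \<open>
  A permutation of \<open>S\<^sub>m\<close> other than the longest one has an ascent inside \<open>{1..m}\<close>; exchanging the two
  values makes it longer, and lengths in \<open>S\<^sub>m\<close> are bounded.
\<close>

lemma longest_perm_induct [consumes 1, case_names longest descent]:
  assumes "w permutes {1..m}"
    and "P (longest_perm m)"
    and "\<And>w i. w permutes {1..m} \<Longrightarrow> is_descent w i \<Longrightarrow> i < m \<Longrightarrow> P w \<Longrightarrow> P (w \<circ> adj_transp i)"
  shows "P w"
  using assms(1)
proof (induction "m * m - perm_length w" arbitrary: w rule: less_induct)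
  case less
  show ?case
  proof (cases "w = longest_perm m")
    case True
    then show ?thesis using assms(2) by simp
  next
    case False
    then obtain i where i: "1 \<le> i" "i < m" "\<not> is_descent w i"
      using all_descents_imp_longest[OF less.prems] by blast
    let ?v = "w \<circ> adj_transp i"
    have v: "?v permutes {1..m}"
      by (rule comp_adj_transp_permutes[OF less.prems i(1,2)])
    have "perm_length ?v = Suc (perm_length w)"
      by (rule perm_length_ascent[OF S_infI[OF less.prems] i(1,3)])
    then have "P ?v"
      using perm_length_le[OF v] by (intro less.hyps v) simp
    moreover have "is_descent ?v i"
      using is_descent_comp_adj_transp[OF S_infI[OF less.prems] i(1)] i(3) by simp
    ultimately show ?thesis
      using assms(3)[OF v _ i(2)] by simp
  qed
qed

lemma perm_length_longest_less:
  assumes "w permutes {1..m}" "w \<noteq> longest_perm m"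
  shows "perm_length w < perm_length (longest_perm m)"
proof -
  have "perm_length w < perm_length (longest_perm m) \<or> w = longest_perm m"
    using assms(1)
  proof (induction w rule: longest_perm_induct)
    case (descent w i)
    have "perm_length (w \<circ> adj_transp i) < perm_length w"
      using perm_length_descent[OF S_infI[OF descent.hyps(1)] descent.hyps(2)] by simp
    then have "perm_length (w \<circ> adj_transp i) < perm_length (longest_perm m)"
      using descent.IH by auto
    then show ?case ..
  qed simp
  with assms(2) show ?thesis by simp
qed

section \<open>Coefficient functionals\<close>

text \<open>
  The constant term of \<open>\<partial>\<^sub>w f\<close>, where \<open>\<partial>\<^sub>w\<close> is the composite of divided differences along a
  chain of descents from \<open>w\<close> down to the identity. The chain is fixed by taking the least descent
  at each step; independence of this choice is \<open>schubert_functional_descent\<close> below.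
\<close>

primrec const_div_diff :: "nat \<Rightarrow> (nat \<Rightarrow> nat) \<Rightarrow> mpoly \<Rightarrow> int" where
  "const_div_diff 0 w f = coeff f 0"
| "const_div_diff (Suc k) w f =
     (let i = (LEAST i. is_descent w i) in const_div_diff k (w \<circ> adj_transp i) (div_diff i f))"

definition schubert_functional :: "(nat \<Rightarrow> nat) \<Rightarrow> mpoly \<Rightarrow> int" (\<open>\<epsilon>\<close>) where
  "\<epsilon> w f = const_div_diff (perm_length w) w f"

lemma schubert_functional_id [simp]: "\<epsilon> id f = coeff f 0"
  by (simp add: schubert_functional_def)

text \<open>
  Two descents of \<open>w\<close> either commute or are the first steps of the two sides of a braid relation,
  so by induction on the length both choices lead to the same value.
\<close>

lemma schubert_functional_descent:
  assumes "w \<in> S_inf" "is_descent w i"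
  shows "\<epsilon> w f = \<epsilon> (w \<circ> adj_transp i) (div_diff i f)"
  using assms
proof (induction "perm_length w" arbitrary: w i f rule: less_induct)
  case less
  note w = \<open>w \<in> S_inf\<close>
  have step: "\<epsilon> v g = \<epsilon> (v \<circ> adj_transp k) (div_diff k g)"
    if "perm_length v < perm_length w" "v \<in> S_inf" "is_descent v k" for v k g
    using less.hyps[OF that] .
  have diamond: "\<epsilon> (w \<circ> adj_transp i) (div_diff i f) = \<epsilon> (w \<circ> adj_transp j) (div_diff j f)"
    if i: "is_descent w i" and j: "is_descent w j" and "i < j" for i j
  proof -
    let ?s = adj_transp
    have pos: "1 \<le> i" "1 \<le> j" using i j by (auto simp: is_descent_def)
    have S: "w \<circ> ?s i \<in> S_inf" "w \<circ> ?s j \<in> S_inf"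
      using w pos comp_adj_transp_in_S_inf by auto
    have len: "perm_length (w \<circ> ?s i) < perm_length w" "perm_length (w \<circ> ?s j) < perm_length w"
      using perm_length_descent[OF w i] perm_length_descent[OF w j] by linarith+
    show ?thesis
    proof (cases "j = Suc i")
      case False
      with \<open>i < j\<close> have ij: "Suc i < j" by simp
      have d: "is_descent (w \<circ> ?s i) j" "is_descent (w \<circ> ?s j) i"
        using i j ij by (auto simp: is_descent_def transpose_def)
      have "\<epsilon> (w \<circ> ?s i) (div_diff i f) = \<epsilon> (w \<circ> ?s i \<circ> ?s j) (div_diff j (div_diff i f))"
        by (rule step[OF len(1) S(1) d(1)])
      also have "w \<circ> ?s i \<circ> ?s j = w \<circ> ?s j \<circ> ?s i"
        using ij by (auto simp: fun_eq_iff transpose_def)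
      also have "div_diff j (div_diff i f) = div_diff i (div_diff j f)"
        by (rule div_diff_commute[OF ij, symmetric])
      also have "\<epsilon> (w \<circ> ?s j \<circ> ?s i) (div_diff i (div_diff j f)) = \<epsilon> (w \<circ> ?s j) (div_diff j f)"
        by (rule step[OF len(2) S(2) d(2), symmetric])
      finally show ?thesis .
    next
      case [simp]: True
      have d: "is_descent (w \<circ> ?s i) j" "is_descent (w \<circ> ?s j) i"
        using i j by (auto simp: is_descent_def transpose_def)
      have d': "is_descent (w \<circ> ?s i \<circ> ?s j) i" "is_descent (w \<circ> ?s j \<circ> ?s i) j"
        using i j by (auto simp: is_descent_def transpose_def)
      have S': "w \<circ> ?s i \<circ> ?s j \<in> S_inf" "w \<circ> ?s j \<circ> ?s i \<in> S_inf"
        using S pos comp_adj_transp_in_S_inf by auto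
      have len': "perm_length (w \<circ> ?s i \<circ> ?s j) < perm_length w" "perm_length (w \<circ> ?s j \<circ> ?s i) < perm_length w"
        using perm_length_descent[OF S(1) d(1)] perm_length_descent[OF S(2) d(2)] len by linarith+
      have "\<epsilon> (w \<circ> ?s i) (div_diff i f)
          = \<epsilon> (w \<circ> ?s i \<circ> ?s j \<circ> ?s i) (div_diff i (div_diff j (div_diff i f)))"
        by (simp only: step[OF len(1) S(1) d(1)] step[OF len'(1) S'(1) d'(1)])
      also have "w \<circ> ?s i \<circ> ?s j \<circ> ?s i = w \<circ> ?s j \<circ> ?s i \<circ> ?s j"
        by (auto simp: fun_eq_iff transpose_def)
      also have "div_diff i (div_diff j (div_diff i f)) = div_diff j (div_diff i (div_diff j f))"
        by (simp add: div_diff_braid)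
      also have "\<epsilon> (w \<circ> ?s j \<circ> ?s i \<circ> ?s j) \<dots> = \<epsilon> (w \<circ> ?s j) (div_diff j f)"
        by (simp only: step[OF len(2) S(2) d(2)] step[OF len'(2) S'(2) d'(2)])
      finally show ?thesis .
    qed
  qed
  define l where "l = (LEAST i. is_descent w i)"
  have l: "is_descent w l"
    unfolding l_def by (rule LeastI) (fact less.prems(2))
  have "\<epsilon> w f = \<epsilon> (w \<circ> adj_transp l) (div_diff l f)"
    unfolding schubert_functional_def
    using perm_length_descent[OF w l] by (simp add: l_def Let_def)
  also have "\<dots> = \<epsilon> (w \<circ> adj_transp i) (div_diff i f)"
  proof (cases l i rule: linorder_cases)
    case less
    then show ?thesis by (rule diamond[OF l \<open>is_descent w i\<close>])
  next
    case greater
    then show ?thesis by (rule diamond[OF \<open>is_descent w i\<close> l, symmetric])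
  qed simp
  finally show ?case .
qed

text \<open>
  Independence of the chain allows induction along any descent, which is how the functionals are
  handled from here on.
\<close>

lemma descent_induct [consumes 1, case_names id descent]:
  assumes "w \<in> S_inf" "P id"
    and "\<And>w i. w \<in> S_inf \<Longrightarrow> is_descent w i \<Longrightarrow> w \<circ> adj_transp i \<in> S_inf \<Longrightarrow> P (w \<circ> adj_transp i) \<Longrightarrow> P w"
  shows "P w"
  using assms(1)
proof (induction "perm_length w" arbitrary: w rule: less_induct)
  case less
  show ?case
  proof (cases "w = id")
    case False
    then obtain i where i: "is_descent w i"
      using exists_descent[OF less.prems] by blast
    then have "w \<circ> adj_transp i \<in> S_inf"
      using comp_adj_transp_in_S_inf[OF less.prems] by (simp add: is_descent_def)
    moreover have "perm_length (w \<circ> adj_transp i) < perm_length w"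
      using perm_length_descent[OF less.prems i] by simp
    ultimately show ?thesis
      using less.hyps assms(3)[OF less.prems i] by blast
  qed (use assms(2) in simp)
qed

lemma schubert_functional_zero [simp]: "w \<in> S_inf \<Longrightarrow> \<epsilon> w 0 = 0"
proof (induction w rule: descent_induct)
  case id
  show "\<epsilon> id 0 = 0" by simp
next
  case (descent w i)
  have "\<epsilon> (w \<circ> adj_transp i) 0 = 0" by (rule descent.IH)
  then show ?case
    using schubert_functional_descent[OF descent.hyps(1,2)] by simp
qed

lemma schubert_functional_add: "w \<in> S_inf \<Longrightarrow> \<epsilon> w (f + g) = \<epsilon> w f + \<epsilon> w g"
proof (induction w arbitrary: f g rule: descent_induct)
  case id
  show "\<epsilon> id (f + g) = \<epsilon> id f + \<epsilon> id g" by (simp add: lookup_add)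
next
  case (descent w i)
  have "\<epsilon> (w \<circ> adj_transp i) (div_diff i f + div_diff i g)
      = \<epsilon> (w \<circ> adj_transp i) (div_diff i f) + \<epsilon> (w \<circ> adj_transp i) (div_diff i g)"
    by (rule descent.IH)
  then show ?case
    using schubert_functional_descent[OF descent.hyps(1,2)] by (simp add: div_diff_add)
qed

lemma lookup_of_int_mult: "coeff (of_int c * f) a = c * coeff f a"
proof -
  have "of_int c * f = Poly_Mapping.map ((*) c) f"
    by (simp add: mult_map_scale_conv_mult flip: single_of_int)
  then show ?thesis
    by (simp add: Poly_Mapping.map.rep_eq when_def)
qed

lemma schubert_functional_of_int_mult: "w \<in> S_inf \<Longrightarrow> \<epsilon> w (of_int c * f) = c * \<epsilon> w f"
proof (induction w arbitrary: f rule: descent_induct)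
  case id
  show "\<epsilon> id (of_int c * f) = c * \<epsilon> id f" by (simp add: lookup_of_int_mult)
next
  case (descent w i)
  have "\<epsilon> (w \<circ> adj_transp i) (of_int c * div_diff i f) = c * \<epsilon> (w \<circ> adj_transp i) (div_diff i f)"
    by (rule descent.IH)
  then show ?case
    using schubert_functional_descent[OF descent.hyps(1,2)] by (simp add: div_diff_of_int_mult)
qed

lemma schubert_functional_diff: "w \<in> S_inf \<Longrightarrow> \<epsilon> w (f - g) = \<epsilon> w f - \<epsilon> w g"
  using schubert_functional_add[of w f "- g"] schubert_functional_of_int_mult[of w "- 1" g] by simp

lemma schubert_functional_sum: "w \<in> S_inf \<Longrightarrow> \<epsilon> w (sum h A) = (\<Sum>x\<in>A. \<epsilon> w (h x))"
  by (induction A rule: infinite_finite_induct) (simp_all add: schubert_functional_add)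

text \<open>
  If \<open>i\<close> is a descent of \<open>w\<close>, a second \<open>\<partial>\<^sub>i\<close> can be taken first, and \<open>\<partial>\<^sub>i \<partial>\<^sub>i = 0\<close>; otherwise \<open>\<partial>\<^sub>i\<close> is the
  first step of a chain for \<open>w s\<^sub>i\<close>.
\<close>

lemma schubert_functional_div_diff:
  assumes "w \<in> S_inf" "1 \<le> i"
  shows "\<epsilon> w (div_diff i f) = (if is_descent w i then 0 else \<epsilon> (w \<circ> adj_transp i) f)"
proof (cases "is_descent w i")
  case True
  then show ?thesis
    using comp_adj_transp_in_S_inf[OF assms] schubert_functional_descent[OF assms(1)] by simp
next
  case False
  then have "is_descent (w \<circ> adj_transp i) i"
    using is_descent_comp_adj_transp[OF assms] by simp
  then show ?thesis
    using schubert_functional_descent[OF comp_adj_transp_in_S_inf[OF assms]] False by simp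
qed

text \<open>Every divided difference lowers the degree by one, as every descent does with the length.\<close>

lemma schubert_functional_nonzero_degree:
  assumes "w \<in> S_inf" "\<epsilon> w f \<noteq> 0"
  obtains b where "b \<in> Poly_Mapping.keys f" "total_degree b = perm_length w"
proof -
  have "\<exists>b\<in>Poly_Mapping.keys f. total_degree b = perm_length w"
    using assms
  proof (induction w arbitrary: f rule: descent_induct)
    case id
    have "coeff f 0 \<noteq> 0"
      using id by (metis schubert_functional_id)
    then show "\<exists>b\<in>Poly_Mapping.keys f. total_degree b = perm_length id"
      by (intro bexI[of _ 0]) (auto simp: in_keys_iff)
  next
    case (descent w i)
    have "\<epsilon> (w \<circ> adj_transp i) (div_diff i f) \<noteq> 0"
      using descent.prems schubert_functional_descent[OF descent.hyps(1,2)] by simp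
    then obtain a where a: "a \<in> Poly_Mapping.keys (div_diff i f)" "total_degree a = perm_length (w \<circ> adj_transp i)"
      using descent.IH by blast
    from a(1) obtain b where "b \<in> Poly_Mapping.keys f" "div_diff_exponent i b a"
      by (rule keys_div_diff)
    then show ?case
      using a(2) perm_length_descent[OF descent.hyps(1,2)]
      by (auto simp: div_diff_exponent_def)
  qed
  then show ?thesis using that by blast
qed

text \<open>The chain for \<open>w\<close> may start with its last descent.\<close>

lemma schubert_functional_maxd:
  assumes "w \<in> S_inf" "\<epsilon> w f \<noteq> 0" "\<And>i. n < i \<Longrightarrow> div_diff i f = 0"
  shows "maxd w \<le> n"
proof (rule ccontr)
  assume "\<not> maxd w \<le> n"
  then have "is_descent w (maxd w)" "div_diff (maxd w) f = 0"
    using is_descent_maxd[OF assms(1)] assms(3) by auto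
  then have "\<epsilon> w f = 0"
    using schubert_functional_descent[OF assms(1)] comp_adj_transp_in_S_inf[OF assms(1)]
    by (simp add: is_descent_def)
  with assms(2) show False by simp
qed


text \<open>
  The variable with index \<open>0\<close> is never exchanged with another one, so no symmetry argument can
  exclude it.
\<close>

definition avoids_var0 :: "mpoly \<Rightarrow> bool" where
  "avoids_var0 f \<longleftrightarrow> (\<forall>a\<in>Poly_Mapping.keys f. Poly_Mapping.lookup a 0 = 0)"

lemma avoids_var0_div_diff:
  assumes "avoids_var0 f" "1 \<le> i"
  shows "avoids_var0 (div_diff i f)"
  unfolding avoids_var0_def
proof
  fix a assume "a \<in> Poly_Mapping.keys (div_diff i f)"
  then obtain b where "b \<in> Poly_Mapping.keys f" "div_diff_exponent i b a"
    by (rule keys_div_diff)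
  then show "Poly_Mapping.lookup a 0 = 0"
    using assms by (auto simp: avoids_var0_def div_diff_exponent_def)
qed

lemma avoids_var0_minus:
  assumes "avoids_var0 f" "avoids_var0 g"
  shows "avoids_var0 (f - g)"
  unfolding avoids_var0_def
proof
  fix a assume "a \<in> Poly_Mapping.keys (f - g)"
  then have "a \<in> Poly_Mapping.keys f \<union> Poly_Mapping.keys g"
    by (rule subsetD[OF keys_diff])
  then show "Poly_Mapping.lookup a 0 = 0"
    using assms by (auto simp: avoids_var0_def)
qed

lemma keys_subset_weak_comps_avoids_var0:
  "Poly_Mapping.keys f \<subseteq> weak_comps n \<Longrightarrow> avoids_var0 f"
  by (force simp: avoids_var0_def weak_comps_def in_keys_iff)

text \<open>
  A polynomial symmetric in \<open>x\<^sub>n\<^sub>+\<^sub>1, x\<^sub>n\<^sub>+\<^sub>2, \<dots>\<close> does not involve these variables at all: otherwise its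
  symmetry would force infinitely many variables to occur.
\<close>

lemma keys_subset_weak_comps_if_symmetric:
  assumes f: "avoids_var0 f" and sym: "\<And>i. n < i \<Longrightarrow> div_diff i f = 0"
  shows "Poly_Mapping.keys f \<subseteq> weak_comps n"
proof (rule ccontr)
  assume "\<not> Poly_Mapping.keys f \<subseteq> weak_comps n"
  then obtain a j where aj: "a \<in> Poly_Mapping.keys f" "j \<in> Poly_Mapping.keys a" "j \<notin> {1..n}"
    unfolding weak_comps_def by blast
  have "j \<noteq> 0"
    using f aj(1,2) unfolding avoids_var0_def by (metis in_keys_iff)
  with aj(3) have "n < j" by simp
  define J where "J = (\<Union>b\<in>Poly_Mapping.keys f. Poly_Mapping.keys b)"
  have "k \<in> J" if "j \<le> k" for k
    using that
  proof (induction k rule: dec_induct)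
    case base
    then show ?case using aj by (auto simp: J_def)
  next
    case (step k)
    then obtain b where b: "b \<in> Poly_Mapping.keys f" "k \<in> Poly_Mapping.keys b"
      by (auto simp: J_def)
    have "swap_vars k f = f"
      using sym[of k] step.hyps \<open>n < j\<close> by (simp add: div_diff_eq_0_iff)
    then have "coeff f (swap_exps k b) = coeff f b"
      by (metis lookup_swap_vars)
    then have "swap_exps k b \<in> Poly_Mapping.keys f" "Suc k \<in> Poly_Mapping.keys (swap_exps k b)"
      using b by (simp_all add: in_keys_iff)
    then show ?case by (auto simp: J_def)
  qed
  then have "{j..} \<subseteq> J" by auto
  moreover have "finite J" by (simp add: J_def)
  ultimately show False
    using finite_subset infinite_Ici by blast
qed

text \<open>
  If all functionals vanish on \<open>f\<close>, then they vanish on every \<open>\<partial>\<^sub>i f\<close>, so by induction on the degree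
  all divided differences of \<open>f\<close> are zero and \<open>f\<close> is constant.
\<close>

lemma schubert_functionals_separate:
  assumes "avoids_var0 f" "\<And>v. v \<in> S_inf \<Longrightarrow> \<epsilon> v f = 0"
  shows "f = 0"
proof -
  have "f = 0" if "avoids_var0 f" "\<And>v. v \<in> S_inf \<Longrightarrow> \<epsilon> v f = 0"
    "\<forall>a\<in>Poly_Mapping.keys f. total_degree a < d" for d
    using that
  proof (induction d arbitrary: f)
    case 0
    then show ?case by (auto simp flip: keys_eq_empty)
  next
    case (Suc d)
    have "div_diff i f = 0" if "1 \<le> i" for i
    proof (rule Suc.IH)
      show "avoids_var0 (div_diff i f)"
        using Suc.prems(1) that by (rule avoids_var0_div_diff)
      show "\<epsilon> v (div_diff i f) = 0" if "v \<in> S_inf" for v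
        unfolding schubert_functional_div_diff[OF that \<open>1 \<le> i\<close>]
          Suc.prems(2)[OF comp_adj_transp_in_S_inf[OF that \<open>1 \<le> i\<close>]] by simp
      show "\<forall>a\<in>Poly_Mapping.keys (div_diff i f). total_degree a < d"
      proof
        fix a assume "a \<in> Poly_Mapping.keys (div_diff i f)"
        then obtain b where "b \<in> Poly_Mapping.keys f" "div_diff_exponent i b a"
          by (rule keys_div_diff)
        then show "total_degree a < d"
          using Suc.prems(3) by (auto simp: div_diff_exponent_def)
      qed
    qed
    then have "Poly_Mapping.keys f \<subseteq> weak_comps 0"
      using Suc.prems(1) by (intro keys_subset_weak_comps_if_symmetric) auto
    then have "Poly_Mapping.keys f \<subseteq> {0}"
      by (auto simp: weak_comps_def)
    moreover have "0 \<notin> Poly_Mapping.keys f"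
      using Suc.prems(2)[OF id_in_S_inf] unfolding schubert_functional_id by (simp add: in_keys_iff)
    ultimately show ?case
      by (metis keys_eq_empty subset_singletonD insertI1)
  qed
  moreover have "\<exists>d. \<forall>a\<in>Poly_Mapping.keys f. total_degree a < d"
    using finite_nat_set_iff_bounded[of "total_degree ` Poly_Mapping.keys f"] by auto
  ultimately show ?thesis
    using assms by blast
qed

text \<open>
  Only the finitely many \<open>i\<close> for which \<open>x\<^sub>i\<close> or \<open>x\<^sub>i\<^sub>+\<^sub>1\<close> occurs in \<open>f\<close> can start a chain with a nonzero
  result, and each \<open>\<partial>\<^sub>i f\<close> has smaller degree.
\<close>

lemma finite_nonzero_functionals: "finite {v \<in> S_inf. \<epsilon> v f \<noteq> 0}"
proof -
  have "finite {v \<in> S_inf. \<epsilon> v f \<noteq> 0}" if "\<forall>a\<in>Poly_Mapping.keys f. total_degree a < d" for d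
    using that
  proof (induction d arbitrary: f)
    case 0
    then have "f = 0" by (auto simp flip: keys_eq_empty)
    then show ?case by (auto intro: finite_subset[of _ "{}"])
  next
    case (Suc d)
    define I where "I = {i. 1 \<le> i \<and> div_diff i f \<noteq> 0}"
    define V where "V i = {v \<in> S_inf. \<epsilon> v (div_diff i f) \<noteq> 0}" for i
    define J where "J = (\<Union>b\<in>Poly_Mapping.keys f. Poly_Mapping.keys b)"
    have "I \<subseteq> J \<union> (\<lambda>k. k - 1) ` J"
    proof
      fix i assume "i \<in> I"
      then obtain a where "a \<in> Poly_Mapping.keys (div_diff i f)"
        by (auto simp: I_def simp flip: keys_eq_empty)
      then obtain b where b: "b \<in> Poly_Mapping.keys f" "div_diff_exponent i b a"
        by (rule keys_div_diff)
      then have "i \<in> Poly_Mapping.keys b \<or> Suc i \<in> Poly_Mapping.keys b"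
        by (auto simp: div_diff_exponent_def in_keys_iff)
      then have "i \<in> J \<or> Suc i \<in> J"
        using b(1) by (auto simp: J_def)
      then show "i \<in> J \<union> (\<lambda>k. k - 1) ` J"
        by force
    qed
    then have finI: "finite I"
      by (rule finite_subset) (simp add: J_def)
    have finV: "finite (V i)" for i
      unfolding V_def
    proof (rule Suc.IH, rule ballI)
      fix a assume "a \<in> Poly_Mapping.keys (div_diff i f)"
      then obtain b where "b \<in> Poly_Mapping.keys f" "div_diff_exponent i b a"
        by (rule keys_div_diff)
      then show "total_degree a < d"
        using Suc.prems by (auto simp: div_diff_exponent_def)
    qed
    have "{v \<in> S_inf. \<epsilon> v f \<noteq> 0} \<subseteq> insert id (\<Union>i\<in>I. (\<lambda>u. u \<circ> adj_transp i) ` V i)"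
    proof
      fix v assume v: "v \<in> {v \<in> S_inf. \<epsilon> v f \<noteq> 0}"
      show "v \<in> insert id (\<Union>i\<in>I. (\<lambda>u. u \<circ> adj_transp i) ` V i)"
      proof (cases "v = id")
        case False
        then obtain i where i: "is_descent v i"
          using v exists_descent by blast
        then have "1 \<le> i" by (simp add: is_descent_def)
        have u: "v \<circ> adj_transp i \<in> S_inf"
          using v \<open>1 \<le> i\<close> comp_adj_transp_in_S_inf by blast
        have "\<epsilon> (v \<circ> adj_transp i) (div_diff i f) \<noteq> 0"
          using v i schubert_functional_descent[of v i f] by simp
        then have "v \<circ> adj_transp i \<in> V i" "i \<in> I"
          using u \<open>1 \<le> i\<close> by (auto simp: V_def I_def)
        moreover have "v = v \<circ> adj_transp i \<circ> adj_transp i"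
          by simp
        ultimately show ?thesis by blast
      qed simp
    qed
    then show ?case
      by (rule finite_subset) (simp add: finI finV)
  qed
  moreover have "\<exists>d. \<forall>a\<in>Poly_Mapping.keys f. total_degree a < d"
    using finite_nat_set_iff_bounded[of "total_degree ` Poly_Mapping.keys f"] by auto
  ultimately show ?thesis by blast
qed

section \<open>Schubert polynomials are dual to the functionals\<close>

lemma prod_var_power:
  assumes "finite A"
  shows "(\<Prod>i\<in>A. var i ^ e i) = monom (\<Sum>i\<in>A. Poly_Mapping.single i (e i)) 1"
proof -
  have "var i ^ k = monom (Poly_Mapping.single i k) 1" for i k
    by (induction k) (simp_all add: var_def mult_single single_one flip: single_add)
  with assms show ?thesis
    by (induction A) (simp_all add: mult_single)
qed

lemma keys_prod_var_power:
  assumes "finite A"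
  shows "Poly_Mapping.keys (\<Prod>i\<in>A. var i ^ e i) = {\<Sum>i\<in>A. Poly_Mapping.single i (e i)}"
  using prod_var_power[OF assms, of e] by simp

abbreviation staircase :: "nat \<Rightarrow> mpoly" where
  "staircase m \<equiv> \<Prod>i\<in>{1..m}. var i ^ (m - i)"

lemma lookup_staircase_exponent:
  fixes m j :: nat
  shows "Poly_Mapping.lookup (\<Sum>i\<in>{1..m}. Poly_Mapping.single i (m - i)) j = (if 1 \<le> j then m - j else 0)"
proof -
  have "Poly_Mapping.lookup (\<Sum>i\<in>{1..m}. Poly_Mapping.single i (m - i)) j = (\<Sum>i\<in>{1..m}. if i = j then m - i else 0)"
    by (simp only: lookup_sum lookup_single when_def)
  also have "\<dots> = (if j \<in> {1..m} then m - j else 0)"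
    by (rule sum.delta) simp
  finally show ?thesis by auto
qed

text \<open>
  The polynomials all of whose exponents are bounded by the staircase \<open>(m-1, \<dots>, 1, 0, \<dots>)\<close> form a
  space stable under \<open>\<partial>\<^sub>1, \<dots>, \<partial>\<^sub>m\<^sub>-\<^sub>1\<close> and killed by the other divided differences; so only the
  functionals of permutations in \<open>S\<^sub>m\<close> can be nonzero on it.
\<close>

definition below_staircase :: "nat \<Rightarrow> mpoly \<Rightarrow> bool" where
  "below_staircase m f \<longleftrightarrow> (\<forall>a\<in>Poly_Mapping.keys f. \<forall>i\<ge>1. Poly_Mapping.lookup a i \<le> m - i)"

lemma below_staircase_div_diff:
  assumes f: "below_staircase m f" and "1 \<le> i"
  shows "below_staircase m (div_diff i f)" "m \<le> i \<Longrightarrow> div_diff i f = 0"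
proof -
  have *: "(\<forall>j\<ge>1. Poly_Mapping.lookup a j \<le> m - j) \<and> i < m" if a: "a \<in> Poly_Mapping.keys (div_diff i f)" for a
  proof -
    from a obtain b where "b \<in> Poly_Mapping.keys f" and ba: "div_diff_exponent i b a"
      by (rule keys_div_diff)
    then have b: "Poly_Mapping.lookup b j \<le> m - j" if "1 \<le> j" for j
      using f that by (auto simp: below_staircase_def)
    have max: "max (Poly_Mapping.lookup b i) (Poly_Mapping.lookup b (Suc i)) \<le> m - i"
      using b[of i] b[of "Suc i"] \<open>1 \<le> i\<close> by auto
    then have "Poly_Mapping.lookup a i \<le> m - i" "Poly_Mapping.lookup a (Suc i) \<le> m - Suc i" "i < m"
      using ba by (auto simp: div_diff_exponent_def)
    moreover have "Poly_Mapping.lookup a j \<le> m - j" if "1 \<le> j" "j \<noteq> i" "j \<noteq> Suc i" for j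
      using b[OF that(1)] ba that by (simp add: div_diff_exponent_def)
    ultimately show ?thesis by metis
  qed
  show "below_staircase m (div_diff i f)"
    using * by (auto simp: below_staircase_def)
  show "div_diff i f = 0" if "m \<le> i"
    using * that by (force simp flip: keys_eq_empty)
qed

lemma schubert_functional_below_staircase:
  assumes "v \<in> S_inf" "below_staircase m f" "\<epsilon> v f \<noteq> 0"
  shows "v permutes {1..m}"
  using assms
proof (induction v arbitrary: f rule: descent_induct)
  case id
  show "id permutes {1..m}" by (rule permutes_id)
next
  case (descent w i)
  let ?v = "w \<circ> adj_transp i"
  have i: "1 \<le> i" using descent.hyps(2) by (simp add: is_descent_def)
  have nz: "\<epsilon> ?v (div_diff i f) \<noteq> 0"
    using descent.prems(2) schubert_functional_descent[OF descent.hyps(1,2)] by simp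
  have v: "?v permutes {1..m}"
    by (rule descent.IH[OF below_staircase_div_diff(1)[OF descent.prems(1) i] nz])
  have "i < m"
    using below_staircase_div_diff(2)[OF descent.prems(1) i] nz descent.hyps(3) by (metis leI schubert_functional_zero)
  then show ?case
    using comp_adj_transp_permutes[OF v i] by simp
qed

lemma below_staircase_staircase: "below_staircase m (staircase m)"
  unfolding below_staircase_def keys_prod_var_power[OF finite_atLeastAtMost]
  by (simp only: ball_simps lookup_staircase_exponent) simp

lemma div_diff_var_mult_symmetric:
  assumes "swap_vars i g = g"
  shows "div_diff i (var i * g) = g"
proof -
  have "div_diff i (var i) = 1"
    by (rule div_diff_eqI) simp
  then show ?thesis
    using div_diff_mult_symmetric[OF assms, of "var i"] by (simp add: mult.commute)
qed

text \<open>
  The operator \<open>\<partial>\<^sub>m \<cdots> \<partial>\<^sub>1\<close> takes the staircase monomial of \<open>m + 1\<close> to that of \<open>m\<close>, and it corresponds to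
  moving the value \<open>m + 1\<close> of the longest permutation from the first to the last place. The
  intermediate permutations and monomials are \<open>W k\<close> and \<open>C k\<close>.
\<close>

lemma schubert_functional_staircase_Suc:
  "\<epsilon> (longest_perm (Suc m)) (staircase (Suc m)) = \<epsilon> (longest_perm m) (staircase m)"
proof -
  define W where "W k i = (if i \<in> {1..k} then m + 1 - i else if i = k + 1 then m + 1
      else if i \<in> {k+2..m+1} then m + 2 - i else i)" for k i
  define e where "e k i = (if i \<le> k then m - i else Suc m - i)" for k i
  define C where "C k = (\<Prod>i\<in>{1..Suc m}. var i ^ e k i)" for k
  have W0: "W 0 = longest_perm (Suc m)" and Wm: "W m = longest_perm m"
    by (auto simp: fun_eq_iff W_def longest_perm_def)
  have C0: "C 0 = staircase (Suc m)"
    unfolding C_def by (intro prod.cong) (auto simp: e_def)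
  have Cm: "C m = staircase m"
    unfolding C_def by (simp add: e_def)
  have step: "W k \<in> S_inf \<and> \<epsilon> (W k) (C k) = \<epsilon> (W 0) (C 0)" if "k \<le> m" for k
    using that
  proof (induction k)
    case 0
    then show ?case
      using S_infI[OF longest_perm_permutes] by (simp add: W0)
  next
    case (Suc k)
    then have k: "k < m" and WS: "W k \<in> S_inf" and IH: "\<epsilon> (W k) (C k) = \<epsilon> (W 0) (C 0)"
      by auto
    let ?i = "Suc k"
    have d: "is_descent (W k) ?i"
      using k by (auto simp: is_descent_def W_def)
    have W: "W (Suc k) = W k \<circ> adj_transp ?i"
      using k by (auto simp: fun_eq_iff W_def transpose_def)
    have "swap_vars ?i (C (Suc k)) = (\<Prod>i\<in>{1..Suc m}. var (adj_transp ?i i) ^ e (Suc k) i)"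
      by (simp add: C_def swap_vars_prod)
    also have "\<dots> = C (Suc k)"
      unfolding C_def
      by (rule prod.reindex_bij_witness[where i = "adj_transp ?i" and j = "adj_transp ?i"])
        (use k in \<open>auto simp: e_def transpose_def\<close>)
    finally have sym: "swap_vars ?i (C (Suc k)) = C (Suc k)" .
    have "C k = var ?i ^ e k ?i * (\<Prod>i\<in>{1..Suc m} - {?i}. var i ^ e k i)"
      unfolding C_def by (rule prod.remove) (use k in auto)
    also have "\<dots> = var ?i * (var ?i ^ e (Suc k) ?i * (\<Prod>i\<in>{1..Suc m} - {?i}. var i ^ e (Suc k) i))"
    proof -
      have "e k ?i = Suc (e (Suc k) ?i)"
        using k by (simp add: e_def)
      moreover have "(\<Prod>i\<in>{1..Suc m} - {?i}. var i ^ e k i) = (\<Prod>i\<in>{1..Suc m} - {?i}. var i ^ e (Suc k) i)"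
        by (rule prod.cong) (auto simp: e_def)
      ultimately show ?thesis by (simp add: mult.assoc)
    qed
    also have "\<dots> = var ?i * C (Suc k)"
      unfolding C_def by (subst prod.remove[of "{1..Suc m}" ?i]) (use k in auto)
    finally have "div_diff ?i (C k) = C (Suc k)"
      by (simp add: div_diff_var_mult_symmetric[OF sym])
    then have "\<epsilon> (W (Suc k)) (C (Suc k)) = \<epsilon> (W 0) (C 0)"
      using schubert_functional_descent[OF WS d, of "C k"] IH unfolding W by simp
    moreover have "W (Suc k) \<in> S_inf"
      unfolding W by (rule comp_adj_transp_in_S_inf[OF WS]) simp
    ultimately show ?case by blast
  qed
  show ?thesis
    using step[of m] by (simp add: W0 Wm C0 Cm)
qed

text \<open>
  The value \<open>1\<close> at the longest permutation forces its length to be the degree of the staircase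
  monomial, and any other permutation of \<open>S\<^sub>m\<close> is too short for that degree.
\<close>

lemma schubert_functional_staircase:
  assumes "v \<in> S_inf"
  shows "\<epsilon> v (staircase m) = (if v = longest_perm m then 1 else 0)"
proof -
  have one: "\<epsilon> (longest_perm m) (staircase m) = 1"
  proof (induction m)
    case 0
    have "longest_perm 0 = id"
      by (auto simp: longest_perm_def fun_eq_iff)
    moreover have "\<epsilon> id (staircase 0) = 1"
      by simp
    ultimately show ?case by metis
  next
    case (Suc m)
    then show ?case by (simp only: schubert_functional_staircase_Suc)
  qed
  have deg: "perm_length u = total_degree (\<Sum>i\<in>{1..m}. Poly_Mapping.single i (m - i))"
    if "u \<in> S_inf" "\<epsilon> u (staircase m) \<noteq> 0" for u
    using that by (rule schubert_functional_nonzero_degree)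
      (simp add: keys_prod_var_power[OF finite_atLeastAtMost])
  have "v = longest_perm m" if "\<epsilon> v (staircase m) \<noteq> 0"
  proof (rule ccontr)
    assume "v \<noteq> longest_perm m"
    moreover have "v permutes {1..m}"
      by (rule schubert_functional_below_staircase[OF assms below_staircase_staircase that])
    ultimately have "perm_length v < perm_length (longest_perm m)"
      by (intro perm_length_longest_less)
    then show False
      using deg[OF assms that] deg[OF S_infI[OF longest_perm_permutes[of m]]] one by simp
  qed
  then show ?thesis
    using one by (metis (full_types))
qed

lemma is_schubert_in_S_inf: "is_schubert w f \<Longrightarrow> w \<in> S_inf"
proof (induction rule: is_schubert.induct)
  case (longest m)
  show ?case by (rule S_infI[OF longest_perm_permutes])
next
  case (descent w f i)
  show ?case by (rule comp_adj_transp_in_S_inf[OF descent.IH descent.hyps(2)])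
qed

text \<open>
  The duality passes along descents because \<open>\<epsilon>\<^sub>v (\<partial>\<^sub>i f)\<close> is either zero or \<open>\<epsilon>\<close> of \<open>v s\<^sub>i\<close> at \<open>f\<close>. As the
  functionals separate polynomials, it determines \<open>f\<close> from \<open>w\<close> alone, whatever chain led to \<open>f\<close>: this
  is the well-definedness of Schubert polynomials.
\<close>

lemma is_schubert_functional:
  assumes "is_schubert w f" "v \<in> S_inf"
  shows "\<epsilon> v f = (if v = w then 1 else 0)"
  using assms
proof (induction arbitrary: v rule: is_schubert.induct)
  case (longest m)
  then show ?case by (rule schubert_functional_staircase)
next
  case (descent w f i)
  have d: "is_descent w i"
    using descent.hyps by (simp add: is_descent_def)
  have "w \<in> S_inf"
    using descent.hyps(1) by (rule is_schubert_in_S_inf)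
  then have nd: "\<not> is_descent (w \<circ> adj_transp i) i"
    using is_descent_comp_adj_transp descent.hyps(2) d by blast
  show ?case
  proof (cases "is_descent v i")
    case True
    then have "v \<noteq> w \<circ> adj_transp i"
      using nd by blast
    moreover have "\<epsilon> v (div_diff i f) = 0"
      using True schubert_functional_div_diff[OF descent.prems descent.hyps(2)] by simp
    ultimately show ?thesis
      by (simp only: if_False)
  next
    case False
    have "\<epsilon> v (div_diff i f) = \<epsilon> (v \<circ> adj_transp i) f"
      using False schubert_functional_div_diff[OF descent.prems descent.hyps(2)] by simp
    also have "\<dots> = (if v \<circ> adj_transp i = w then 1 else 0)"
      by (rule descent.IH[OF comp_adj_transp_in_S_inf[OF descent.prems descent.hyps(2)]])
    finally show ?thesis
      by (simp only: comp_adj_transp_eq_iff)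
  qed
qed

lemma is_schubert_avoids_var0: "is_schubert w f \<Longrightarrow> avoids_var0 f"
proof (induction rule: is_schubert.induct)
  case (longest m)
  show ?case
    unfolding avoids_var0_def keys_prod_var_power[OF finite_atLeastAtMost]
    by (simp only: ball_simps lookup_staircase_exponent) simp
qed (rule avoids_var0_div_diff)

lemma is_schubert_homogeneous:
  "is_schubert w f \<Longrightarrow> \<exists>d. \<forall>a\<in>Poly_Mapping.keys f. total_degree a = d"
proof (induction rule: is_schubert.induct)
  case (longest m)
  show ?case
    unfolding keys_prod_var_power[OF finite_atLeastAtMost] by simp
next
  case (descent w f i)
  then obtain d where d: "\<forall>a\<in>Poly_Mapping.keys f. total_degree a = d"
    by blast
  have "total_degree a = d - 1" if "a \<in> Poly_Mapping.keys (div_diff i f)" for a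
    using that by (rule keys_div_diff) (use d in \<open>auto simp: div_diff_exponent_def\<close>)
  then show ?case by blast
qed

lemma is_schubert_exists:
  assumes "w \<in> S_inf"
  shows "\<exists>f. is_schubert w f"
proof -
  obtain m where "w permutes {1..m}"
    using S_inf_bounded[OF assms] .
  then show ?thesis
  proof (induction w rule: longest_perm_induct)
    case longest
    show ?case by (rule exI, rule is_schubert.longest)
  next
    case (descent w i)
    obtain f where f: "is_schubert w f"
      using descent.IH by (rule exE)
    have "1 \<le> i" "w (Suc i) < w i"
      using descent.hyps(2) by (simp_all add: is_descent_def)
    then show ?case
      by (intro exI) (rule is_schubert.descent[OF f])
  qed
qed

lemma is_schubert_unique:
  assumes "is_schubert w f" "is_schubert w g"
  shows "f = g"
proof -
  have "avoids_var0 (f - g)"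
    using assms[THEN is_schubert_avoids_var0] by (rule avoids_var0_minus)
  moreover have "\<epsilon> v (f - g) = 0" if "v \<in> S_inf" for v
    unfolding schubert_functional_diff[OF that] is_schubert_functional[OF assms(1) that]
      is_schubert_functional[OF assms(2) that] by (rule diff_self)
  ultimately have "f - g = 0"
    by (rule schubert_functionals_separate)
  then show ?thesis by simp
qed

lemma is_schubert_schubert:
  assumes "w \<in> S_inf"
  shows "is_schubert w (schubert w)"
proof -
  obtain f where f: "is_schubert w f"
    using is_schubert_exists[OF assms] by (rule exE)
  show ?thesis
    unfolding schubert_def by (rule theI[of "is_schubert w", OF f]) (rule is_schubert_unique[OF _ f])
qed

lemma schubert_functional_schubert:
  assumes "v \<in> S_inf" "w \<in> S_inf"
  shows "\<epsilon> v (schubert w) = (if v = w then 1 else 0)"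
  using is_schubert_functional[OF is_schubert_schubert[OF assms(2)] assms(1)] .

lemma avoids_var0_schubert: "w \<in> S_inf \<Longrightarrow> avoids_var0 (schubert w)"
  by (rule is_schubert_avoids_var0[OF is_schubert_schubert])

text \<open>
  Homogeneity is inherited along descents; the degree must be the length since the functional of
  \<open>w\<close> does not vanish.
\<close>

lemma total_degree_schubert:
  assumes "w \<in> S_inf" "a \<in> Poly_Mapping.keys (schubert w)"
  shows "total_degree a = perm_length w"
proof -
  have "\<epsilon> w (schubert w) \<noteq> 0"
    by (simp add: schubert_functional_schubert[OF assms(1,1)])
  then obtain b where b: "b \<in> Poly_Mapping.keys (schubert w)" "total_degree b = perm_length w"
    by (rule schubert_functional_nonzero_degree[OF assms(1)])
  obtain d where d: "\<forall>a\<in>Poly_Mapping.keys (schubert w). total_degree a = d"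
    using is_schubert_homogeneous[OF is_schubert_schubert[OF assms(1)]] by (rule exE)
  show ?thesis
    using bspec[OF d b(1)] bspec[OF d assms(2)] b(2) by simp
qed

lemma div_diff_schubert_eq_0:
  assumes "w \<in> S_inf" "1 \<le> i" "\<not> is_descent w i"
  shows "div_diff i (schubert w) = 0"
proof (rule schubert_functionals_separate)
  show "avoids_var0 (div_diff i (schubert w))"
    using avoids_var0_schubert[OF assms(1)] assms(2) by (rule avoids_var0_div_diff)
  fix v assume v: "v \<in> S_inf"
  show "\<epsilon> v (div_diff i (schubert w)) = 0"
  proof (cases "is_descent v i")
    case False
    then have d: "is_descent (v \<circ> adj_transp i) i"
      using is_descent_comp_adj_transp[OF v assms(2)] by (rule iffD2[rotated])
    have ne: "v \<circ> adj_transp i \<noteq> w"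
    proof
      assume vw: "v \<circ> adj_transp i = w"
      show False
        using assms(3) d unfolding vw by (rule notE)
    qed
    show ?thesis
      unfolding schubert_functional_div_diff[OF v assms(2)]
        schubert_functional_schubert[OF comp_adj_transp_in_S_inf[OF v assms(2)] assms(1)]
      using ne by (simp only: if_False if_cancel)
  qed (simp add: schubert_functional_div_diff[OF v assms(2)])
qed

lemma div_diff_schubert_beyond_maxd:
  assumes "w \<in> S_inf" "maxd w \<le> n" "n < i"
  shows "div_diff i (schubert w) = 0"
  using assms descent_le_maxd[OF assms(1), of i] by (intro div_diff_schubert_eq_0) auto

lemma keys_schubert:
  assumes "w \<in> S_inf" "maxd w \<le> n"
  shows "Poly_Mapping.keys (schubert w) \<subseteq> weak_comps n"
  by (rule keys_subset_weak_comps_if_symmetric[OF avoids_var0_schubert[OF assms(1)]])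
    (rule div_diff_schubert_beyond_maxd[OF assms])

text \<open>Both sides take the same value under every functional.\<close>

lemma schubert_expansion:
  assumes "avoids_var0 f"
  shows "f = (\<Sum>v\<in>{v \<in> S_inf. \<epsilon> v f \<noteq> 0}. of_int (\<epsilon> v f) * schubert v)"
proof -
  let ?V = "{v \<in> S_inf. \<epsilon> v f \<noteq> 0}"
  let ?g = "\<Sum>v\<in>?V. of_int (\<epsilon> v f) * schubert v"
  have "coeff ?g a = 0" if "Poly_Mapping.lookup a 0 \<noteq> 0" for a
    unfolding lookup_sum lookup_of_int_mult
  proof (rule sum.neutral, rule ballI)
    fix v assume "v \<in> ?V"
    then have "a \<notin> Poly_Mapping.keys (schubert v)"
      using avoids_var0_schubert[of v] that by (auto simp: avoids_var0_def)
    then show "\<epsilon> v f * coeff (schubert v) a = 0"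
      by (simp add: in_keys_iff)
  qed
  then have "avoids_var0 ?g"
    unfolding avoids_var0_def in_keys_iff by blast
  with assms have "avoids_var0 (f - ?g)"
    by (rule avoids_var0_minus)
  moreover have "\<epsilon> w (f - ?g) = 0" if w: "w \<in> S_inf" for w
  proof -
    have "\<epsilon> w ?g = (\<Sum>v\<in>?V. if v = w then \<epsilon> v f else 0)"
      unfolding schubert_functional_sum[OF w] schubert_functional_of_int_mult[OF w]
    proof (rule sum.cong[OF refl])
      fix v assume "v \<in> ?V"
      then have "\<epsilon> w (schubert v) = (if w = v then 1 else 0)"
        using schubert_functional_schubert[OF w] by blast
      then show "\<epsilon> v f * \<epsilon> w (schubert v) = (if v = w then \<epsilon> v f else 0)"
        by (simp add: eq_commute[of w v])
    qed
    also have "\<dots> = \<epsilon> w f"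
      using w finite_nonzero_functionals[of f] by simp
    finally show ?thesis
      by (simp add: schubert_functional_diff[OF w])
  qed
  ultimately have "f - ?g = 0"
    by (rule schubert_functionals_separate)
  then show ?thesis by simp
qed


section \<open>Structure constants and the dual basis\<close>

lemma keys_mult_weak_comps:
  fixes f g :: mpoly
  assumes "Poly_Mapping.keys f \<subseteq> weak_comps n" "Poly_Mapping.keys g \<subseteq> weak_comps n"
  shows "Poly_Mapping.keys (f * g) \<subseteq> weak_comps n"
proof
  fix c assume "c \<in> Poly_Mapping.keys (f * g)"
  then obtain a b where "c = a + b" "a \<in> Poly_Mapping.keys f" "b \<in> Poly_Mapping.keys g"
    using subsetD[OF keys_mult[of f g]] by blast
  then show "c \<in> weak_comps n"
    using assms keys_add[of a b] unfolding weak_comps_def by blast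
qed

lemma div_diff_eq_0_beyond_weak_comps:
  assumes "Poly_Mapping.keys f \<subseteq> weak_comps n" "n < i"
  shows "div_diff i f = 0"
proof -
  have "a \<notin> Poly_Mapping.keys (div_diff i f)" for a
  proof
    assume "a \<in> Poly_Mapping.keys (div_diff i f)"
    then obtain b where b: "b \<in> Poly_Mapping.keys f" "div_diff_exponent i b a"
      by (rule keys_div_diff)
    then have "Poly_Mapping.keys b \<subseteq> {1..n}"
      using assms(1) by (auto simp: weak_comps_def)
    then have "i \<notin> Poly_Mapping.keys b" "Suc i \<notin> Poly_Mapping.keys b"
      using assms(2) by auto
    then have "Poly_Mapping.lookup b i = 0" "Poly_Mapping.lookup b (Suc i) = 0"
      by (simp_all add: in_keys_iff)
    then show False
      using b(2) by (simp add: div_diff_exponent_def)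
  qed
  then show ?thesis by (simp flip: keys_eq_empty) blast
qed

lemma maxd_le_if_functional_nonzero:
  assumes "v \<in> S_inf" "\<epsilon> v f \<noteq> 0" "Poly_Mapping.keys f \<subseteq> weak_comps n"
  shows "maxd v \<le> n"
  by (rule schubert_functional_maxd[OF assms(1,2)]) (rule div_diff_eq_0_beyond_weak_comps[OF assms(3)])

lemma monom_eq_of_int_mult: "monom b c = of_int c * monom b 1"
  by (simp add: mult_single flip: single_of_int)

lemma schubert_functional_sum_monom:
  assumes "u \<in> S_inf"
  shows "\<epsilon> u f = (\<Sum>b\<in>Poly_Mapping.keys f. coeff f b * \<epsilon> u (monom b 1))"
proof -
  have "\<epsilon> u f = \<epsilon> u (\<Sum>b\<in>Poly_Mapping.keys f. of_int (coeff f b) * monom b 1)"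
    by (simp only: poly_eq_sum_monom[symmetric] monom_eq_of_int_mult[symmetric])
  then show ?thesis
    by (simp only: schubert_functional_sum[OF assms] schubert_functional_of_int_mult[OF assms])
qed

lemma schubert_functional_of_schubert_sum:
  assumes "x \<in> S_inf" "finite A" "A \<subseteq> S_inf"
  shows "\<epsilon> x (\<Sum>w\<in>A. of_int (k w) * schubert w) = (if x \<in> A then k x else 0)"
proof -
  have "\<epsilon> x (\<Sum>w\<in>A. of_int (k w) * schubert w) = (\<Sum>w\<in>A. if w = x then k w else 0)"
    unfolding schubert_functional_sum[OF assms(1)] schubert_functional_of_int_mult[OF assms(1)]
  proof (rule sum.cong[OF refl])
    fix w assume "w \<in> A"
    then have "\<epsilon> x (schubert w) = (if w = x then 1 else 0)"
      using schubert_functional_schubert[OF assms(1), of w] assms(3) by (metis subsetD)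
    then show "k w * \<epsilon> x (schubert w) = (if w = x then k w else 0)"
      by simp
  qed
  also have "\<dots> = (if x \<in> A then k x else 0)"
    by (rule sum.delta[OF assms(2)])
  finally show ?thesis .
qed

text \<open>
  The functionals read off the coefficients of any Schubert expansion, which makes the expansion
  unique, and \<open>schubert_expansion\<close> provides one with finite support.
\<close>

lemma schubert_coeff_eq_functional:
  assumes "u \<in> S_inf" "v \<in> S_inf" "w \<in> S_inf"
  shows "schubert_coeff u v w = \<epsilon> w (schubert u * schubert v)"
proof -
  define f where "f = schubert u * schubert v"
  define V where "V = {x \<in> S_inf. \<epsilon> x f \<noteq> 0}"
  define P where "P c \<longleftrightarrow> Poly_Mapping.keys c \<subseteq> S_inf \<and>
     f = (\<Sum>w\<in>Poly_Mapping.keys c. of_int (Poly_Mapping.lookup c w) * schubert w)"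
    for c :: "(nat \<Rightarrow> nat) \<Rightarrow>\<^sub>0 int"
  have P_lookup: "Poly_Mapping.lookup c x = (if x \<in> V then \<epsilon> x f else 0)" if "P c" for c x
  proof (cases "x \<in> S_inf")
    case True
    have "\<epsilon> x f = Poly_Mapping.lookup c x"
      using that schubert_functional_of_schubert_sum[OF True finite_keys, of c "Poly_Mapping.lookup c"]
      unfolding P_def in_keys_iff by (metis (full_types))
    then show ?thesis
      using True by (simp add: V_def)
  next
    case False
    then have "x \<notin> Poly_Mapping.keys c"
      using that unfolding P_def by blast
    then show ?thesis
      using False by (simp add: V_def in_keys_iff)
  qed
  define c where "c = Abs_poly_mapping (\<lambda>x. if x \<in> V then \<epsilon> x f else 0)"
  have "finite V"
    unfolding V_def by (rule finite_nonzero_functionals)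
  then have "finite {x. (if x \<in> V then \<epsilon> x f else 0) \<noteq> 0}"
    by (rule rev_finite_subset) (auto split: if_splits)
  then have lookup_c: "Poly_Mapping.lookup c x = (if x \<in> V then \<epsilon> x f else 0)" for x
    unfolding c_def by (subst lookup_Abs_poly_mapping) auto
  have keys_c: "Poly_Mapping.keys c = V"
    unfolding set_eq_iff in_keys_iff lookup_c by (auto simp: V_def)
  have "avoids_var0 f"
    unfolding f_def
    using keys_mult_weak_comps[OF keys_schubert[OF assms(1), of "max (maxd u) (maxd v)"]
      keys_schubert[OF assms(2), of "max (maxd u) (maxd v)"]]
    by (intro keys_subset_weak_comps_avoids_var0) simp
  then have "f = (\<Sum>w\<in>V. of_int (\<epsilon> w f) * schubert w)"
    unfolding V_def by (rule schubert_expansion)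
  also have "\<dots> = (\<Sum>w\<in>Poly_Mapping.keys c. of_int (Poly_Mapping.lookup c w) * schubert w)"
    unfolding keys_c by (rule sum.cong) (simp_all add: lookup_c)
  finally have "P c"
    by (simp add: P_def keys_c V_def)
  moreover have "d = c" if "P d" for d
    by (rule poly_mapping_eqI) (simp only: P_lookup[OF that] lookup_c)
  ultimately have "(THE c. P c) = c"
    by (rule the_equality)
  then have "schubert_coeff u v w = Poly_Mapping.lookup c w"
    unfolding schubert_coeff_def P_def f_def by simp
  also have "\<dots> = \<epsilon> w f"
    using assms(3) by (simp add: lookup_c V_def)
  finally show ?thesis
    by (simp add: f_def)
qed

lemma finite_weak_comps_degree: "finite {b \<in> weak_comps n. total_degree b \<le> d}"
proof -
  let ?B = "{f. \<forall>i. (i \<in> {1..n} \<longrightarrow> f i \<in> {..d}) \<and> (i \<notin> {1..n} \<longrightarrow> f i = 0)}"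
  have "Poly_Mapping.lookup b \<in> ?B" if b: "b \<in> {b \<in> weak_comps n. total_degree b \<le> d}" for b
  proof (intro CollectI allI conjI impI)
    fix i
    show "Poly_Mapping.lookup b i \<in> {..d}"
      using lookup_le_total_degree[of b i] b by simp
    show "Poly_Mapping.lookup b i = 0" if "i \<notin> {1..n}"
      using that b unfolding weak_comps_def in_keys_iff[symmetric] by (auto simp: in_keys_iff)
  qed
  then have "Poly_Mapping.lookup ` {b \<in> weak_comps n. total_degree b \<le> d} \<subseteq> ?B"
    by (rule image_subsetI)
  moreover have "finite ?B"
    by (rule finite_set_of_finite_funs) simp_all
  ultimately have "finite (Poly_Mapping.lookup ` {b \<in> weak_comps n. total_degree b \<le> d})"
    by (rule finite_subset)
  then show ?thesis
    by (rule finite_imageD) (simp add: inj_on_def)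
qed

text \<open>A Schubert polynomial is detected by one of its monomials, and there are finitely many of those.\<close>

lemma finite_maxd_le_length_le: "finite {u \<in> S_inf. maxd u \<le> n \<and> perm_length u \<le> d}"
proof (rule finite_subset)
  let ?B = "{b \<in> weak_comps n. total_degree b \<le> d}"
  show "finite (\<Union>b\<in>?B. {u \<in> S_inf. \<epsilon> u (monom b 1) \<noteq> 0})"
    using finite_weak_comps_degree finite_nonzero_functionals by (rule finite_UN_I)
  show "{u \<in> S_inf. maxd u \<le> n \<and> perm_length u \<le> d} \<subseteq> (\<Union>b\<in>?B. {u \<in> S_inf. \<epsilon> u (monom b 1) \<noteq> 0})"
  proof
    fix u assume "u \<in> {u \<in> S_inf. maxd u \<le> n \<and> perm_length u \<le> d}"
    then have u: "u \<in> S_inf" "maxd u \<le> n" "perm_length u \<le> d"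
      by blast+
    have "\<epsilon> u (schubert u) = 1"
      by (simp add: schubert_functional_schubert[OF u(1,1)])
    then have "(\<Sum>b\<in>Poly_Mapping.keys (schubert u). coeff (schubert u) b * \<epsilon> u (monom b 1)) \<noteq> 0"
      using schubert_functional_sum_monom[OF u(1), of "schubert u"] by simp
    then obtain b where b: "b \<in> Poly_Mapping.keys (schubert u)" "coeff (schubert u) b * \<epsilon> u (monom b 1) \<noteq> 0"
      by (rule sum.not_neutral_contains_not_neutral)
    have "b \<in> weak_comps n"
      by (rule subsetD[OF keys_schubert[OF u(1,2)] b(1)])
    moreover have "total_degree b \<le> d"
      using total_degree_schubert[OF u(1) b(1)] u(3) by simp
    moreover have "\<epsilon> u (monom b 1) \<noteq> 0"
      using b(2) by simp
    ultimately show "u \<in> (\<Union>b\<in>?B. {u \<in> S_inf. \<epsilon> u (monom b 1) \<noteq> 0})"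
      using u(1) by blast
  qed
qed

text \<open>By degrees, a nonzero coefficient requires the lengths of \<open>u\<close> and \<open>v\<close> to add up to that of \<open>w\<close>.\<close>

lemma finite_nonzero_schubert_coeff:
  assumes w: "w \<in> S_inf"
  shows "finite {(u, v). u \<in> S_inf \<and> v \<in> S_inf \<and> maxd u \<le> n \<and> maxd v \<le> n \<and> schubert_coeff u v w \<noteq> 0}"
proof (rule finite_subset)
  let ?U = "{u \<in> S_inf. maxd u \<le> n \<and> perm_length u \<le> perm_length w}"
  show "finite (?U \<times> ?U)"
    using finite_maxd_le_length_le by (intro finite_cartesian_product)
  show "{(u, v). u \<in> S_inf \<and> v \<in> S_inf \<and> maxd u \<le> n \<and> maxd v \<le> n \<and> schubert_coeff u v w \<noteq> 0} \<subseteq> ?U \<times> ?U"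
  proof (rule subsetI, elim CollectE case_prodE conjE)
    fix p u v assume p: "p = (u, v)" and uv: "u \<in> S_inf" "v \<in> S_inf" "maxd u \<le> n" "maxd v \<le> n"
      and "schubert_coeff u v w \<noteq> 0"
    then have "\<epsilon> w (schubert u * schubert v) \<noteq> 0"
      using schubert_coeff_eq_functional[OF uv(1,2) w] by simp
    then obtain c where c: "c \<in> Poly_Mapping.keys (schubert u * schubert v)" "total_degree c = perm_length w"
      by (rule schubert_functional_nonzero_degree[OF w])
    obtain a b where ab: "c = a + b" "a \<in> Poly_Mapping.keys (schubert u)" "b \<in> Poly_Mapping.keys (schubert v)"
      using subsetD[OF keys_mult c(1)] by blast
    have "perm_length u + perm_length v = perm_length w"
      using total_degree_schubert[OF uv(1) ab(2)] total_degree_schubert[OF uv(2) ab(3)] c(2)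
      by (simp add: ab(1) total_degree_add)
    then show "p \<in> ?U \<times> ?U"
      using uv p by simp
  qed
qed

lemma pairing_sum_of_int_mult:
  "pairing \<alpha> (\<Sum>x\<in>A. of_int (k x) * h x) = (\<Sum>x\<in>A. k x * pairing \<alpha> (h x))"
  unfolding pairing_def lookup_sum lookup_of_int_mult sum_distrib_left
  by (subst sum.swap) (simp add: mult.left_commute)

lemma pairing_monom: "pairing \<alpha> (monom b 1) = Poly_Mapping.lookup \<alpha> b"
proof -
  have "pairing \<alpha> (monom b 1) = (\<Sum>a\<in>Poly_Mapping.keys \<alpha>. if a = b then Poly_Mapping.lookup \<alpha> a else 0)"
    unfolding pairing_def by (rule sum.cong) (auto simp: lookup_single when_def)
  also have "\<dots> = Poly_Mapping.lookup \<alpha> b"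
    by (simp add: in_keys_iff)
  finally show ?thesis .
qed

text \<open>
  The Schubert polynomials with last descent at most \<open>n\<close> span \<open>\<int>[x\<^sub>1, \<dots>, x\<^sub>n]\<close>, so the pairings with
  them determine all the others.
\<close>

lemma pairing_eq_functional:
  assumes u: "u \<in> S_inf" "maxd u \<le> n"
    and dual: "\<forall>v\<in>S_inf. maxd v \<le> n \<longrightarrow> pairing \<alpha> (schubert v) = (if u = v then 1 else 0)"
    and f: "Poly_Mapping.keys f \<subseteq> weak_comps n"
  shows "pairing \<alpha> f = \<epsilon> u f"
proof -
  let ?V = "{v \<in> S_inf. \<epsilon> v f \<noteq> 0}"
  have "f = (\<Sum>v\<in>?V. of_int (\<epsilon> v f) * schubert v)"
    using keys_subset_weak_comps_avoids_var0[OF f] by (rule schubert_expansion)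
  then have "pairing \<alpha> f = pairing \<alpha> (\<Sum>v\<in>?V. of_int (\<epsilon> v f) * schubert v)"
    by (rule arg_cong)
  also have "\<dots> = (\<Sum>v\<in>?V. \<epsilon> v f * pairing \<alpha> (schubert v))"
    by (rule pairing_sum_of_int_mult)
  also have "\<dots> = (\<Sum>v\<in>?V. if v = u then \<epsilon> v f else 0)"
  proof (rule sum.cong[OF refl])
    fix v assume "v \<in> ?V"
    then have "v \<in> S_inf" "maxd v \<le> n"
      using maxd_le_if_functional_nonzero[OF _ _ f] by blast+
    then have "pairing \<alpha> (schubert v) = (if u = v then 1 else 0)"
      using dual by blast
    then have "pairing \<alpha> (schubert v) = (if v = u then 1 else 0)"
      by (simp only: eq_commute[of u v])
    then show "\<epsilon> v f * pairing \<alpha> (schubert v) = (if v = u then \<epsilon> v f else 0)"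
      by simp
  qed
  also have "\<dots> = (if u \<in> ?V then \<epsilon> u f else 0)"
    by (rule sum.delta[OF finite_nonzero_functionals])
  also have "\<dots> = \<epsilon> u f"
    using u(1) by simp
  finally show ?thesis .
qed

text \<open>
  The coefficient of \<open>\<Xi>\<^sub>u\<close> at \<open>[b]\<close> is the value of the functional on \<open>x\<^sup>b\<close>. This has finite support
  because it vanishes unless the degree of \<open>b\<close> is the length of \<open>u\<close>.
\<close>

lemma dual_schubert_exists:
  assumes u: "u \<in> S_inf"
  obtains \<alpha> where "\<alpha> \<in> carrier (\<D> n)"
    "\<And>f. Poly_Mapping.keys f \<subseteq> weak_comps n \<Longrightarrow> pairing \<alpha> f = \<epsilon> u f"
proof
  define h where "h b = (if b \<in> weak_comps n then \<epsilon> u (monom b 1) else 0)" for b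
  have "{b. h b \<noteq> 0} \<subseteq> {b \<in> weak_comps n. total_degree b \<le> perm_length u}"
  proof
    fix b assume "b \<in> {b. h b \<noteq> 0}"
    then have b: "b \<in> weak_comps n" "\<epsilon> u (monom b 1) \<noteq> 0"
      by (auto simp: h_def split: if_splits)
    obtain c where "c \<in> Poly_Mapping.keys (monom b 1)" "total_degree c = perm_length u"
      using b(2) by (rule schubert_functional_nonzero_degree[OF u])
    then show "b \<in> {b \<in> weak_comps n. total_degree b \<le> perm_length u}"
      using b(1) by simp
  qed
  then have fin: "finite {b. h b \<noteq> 0}"
    using finite_weak_comps_degree by (rule finite_subset)
  define \<alpha> where "\<alpha> = Abs_poly_mapping h"
  have lookup: "Poly_Mapping.lookup \<alpha> b = h b" for b
    unfolding \<alpha>_def using fin by simp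
  show "\<alpha> \<in> carrier (\<D> n)"
    by (auto simp: dual_group_def in_keys_iff lookup h_def split: if_splits)
  fix f :: mpoly assume f: "Poly_Mapping.keys f \<subseteq> weak_comps n"
  have "pairing \<alpha> f = (\<Sum>b\<in>Poly_Mapping.keys \<alpha> \<union> Poly_Mapping.keys f. h b * coeff f b)"
    unfolding pairing_def lookup
    by (rule sum.mono_neutral_left) (auto simp: in_keys_iff lookup)
  also have "\<dots> = (\<Sum>b\<in>Poly_Mapping.keys f. h b * coeff f b)"
    by (rule sum.mono_neutral_right) (auto simp: in_keys_iff)
  also have "\<dots> = (\<Sum>b\<in>Poly_Mapping.keys f. coeff f b * \<epsilon> u (monom b 1))"
    by (rule sum.cong) (use f in \<open>auto simp: h_def\<close>)
  also have "\<dots> = \<epsilon> u f"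
    by (rule schubert_functional_sum_monom[OF u, symmetric])
  finally show "pairing \<alpha> f = \<epsilon> u f" .
qed

lemma dual_schubert:
  assumes u: "u \<in> S_inf" "maxd u \<le> n"
  shows "\<Xi> n u \<in> carrier (\<D> n)"
    and "Poly_Mapping.keys f \<subseteq> weak_comps n \<Longrightarrow> pairing (\<Xi> n u) f = \<epsilon> u f"
proof -
  define P where "P \<alpha> \<longleftrightarrow> \<alpha> \<in> carrier (\<D> n) \<and>
     (\<forall>v\<in>S_inf. maxd v \<le> n \<longrightarrow> pairing \<alpha> (schubert v) = (if u = v then 1 else 0))" for \<alpha>
  obtain \<alpha> where \<alpha>: "\<alpha> \<in> carrier (\<D> n)"
    and pair: "\<And>f. Poly_Mapping.keys f \<subseteq> weak_comps n \<Longrightarrow> pairing \<alpha> f = \<epsilon> u f"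
    using dual_schubert_exists[OF u(1)] by metis
  have "P \<alpha>"
    unfolding P_def
  proof (intro conjI \<alpha> ballI impI)
    fix v assume v: "v \<in> S_inf" "maxd v \<le> n"
    show "pairing \<alpha> (schubert v) = (if u = v then 1 else 0)"
      unfolding pair[OF keys_schubert[OF v]] by (rule schubert_functional_schubert[OF u(1) v(1)])
  qed
  moreover have "\<beta> = \<alpha>" if "P \<beta>" for \<beta>
  proof (rule poly_mapping_eqI)
    fix b
    have \<beta>: "\<beta> \<in> carrier (\<D> n)"
      using that by (simp add: P_def)
    show "Poly_Mapping.lookup \<beta> b = Poly_Mapping.lookup \<alpha> b"
    proof (cases "b \<in> weak_comps n")
      case True
      then have b: "Poly_Mapping.keys (monom b 1) \<subseteq> weak_comps n"
        by simp
      have "pairing \<beta> (monom b 1) = \<epsilon> u (monom b 1)"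
        using pairing_eq_functional[OF u _ b, of \<beta>] that unfolding P_def by blast
      then show ?thesis
        using pair[OF b] by (simp add: pairing_monom)
    next
      case False
      then have "b \<notin> Poly_Mapping.keys \<alpha>" "b \<notin> Poly_Mapping.keys \<beta>"
        using \<alpha> \<beta> by (auto simp: dual_group_def)
      then show ?thesis by (simp add: in_keys_iff)
    qed
  qed
  ultimately have "(THE \<alpha>. P \<alpha>) = \<alpha>"
    by (rule the_equality)
  then have "\<Xi> n u = \<alpha>"
    unfolding dual_schubert_def P_def .
  then show "\<Xi> n u \<in> carrier (\<D> n)"
    and "Poly_Mapping.keys f \<subseteq> weak_comps n \<Longrightarrow> pairing (\<Xi> n u) f = \<epsilon> u f"
    using \<alpha> pair by simp_all
qed

section \<open>Nondegeneracy of the pairing on the tensor square\<close>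

lemma tensor_kernel_add:
  assumes "x \<in> tensor_kernel (\<D> n) (\<D> n)" "y \<in> tensor_kernel (\<D> n) (\<D> n)"
  shows "x + y \<in> tensor_kernel (\<D> n) (\<D> n)"
  using generate.eng[OF assms[unfolded tensor_kernel_def]] by (simp add: tensor_kernel_def)

lemma tensor_kernel_subgroup:
  "subgroup (tensor_kernel (\<D> n) (\<D> n)) (free_Abelian_group (carrier (\<D> n) \<times> carrier (\<D> n)))"
  by (intro normal_imp_subgroup tensor_kernel_normal group_dual_group)

lemma tensor_kernel_minus:
  assumes "x \<in> tensor_kernel (\<D> n) (\<D> n)"
  shows "- x \<in> tensor_kernel (\<D> n) (\<D> n)"
proof -
  have "x \<in> carrier (free_Abelian_group (carrier (\<D> n) \<times> carrier (\<D> n)))"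
    using subgroup.subset[OF tensor_kernel_subgroup] assms by (rule subsetD)
  then show ?thesis
    using subgroup.m_inv_closed[OF tensor_kernel_subgroup assms] by simp
qed

lemma tensor_kernel_diff:
  assumes "x \<in> tensor_kernel (\<D> n) (\<D> n)" "y \<in> tensor_kernel (\<D> n) (\<D> n)"
  shows "x - y \<in> tensor_kernel (\<D> n) (\<D> n)"
  using tensor_kernel_add[OF assms(1) tensor_kernel_minus[OF assms(2)]] by simp

lemma tensor_relation_in_kernel:
  "r \<in> tensor_relations G H \<Longrightarrow> r \<in> tensor_kernel G H"
  unfolding tensor_kernel_def by (rule generate.incl)

text \<open>
  Representatives, modulo the bilinearity relations, by combinations of pairs of basis elements
  \<open>([a], [b])\<close>. All elements turn out to be reducible.
\<close>

definition reducible :: "nat \<Rightarrow> ((expvec \<Rightarrow>\<^sub>0 int) \<times> (expvec \<Rightarrow>\<^sub>0 int) \<Rightarrow>\<^sub>0 int) \<Rightarrow> bool" where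
  "reducible n z \<longleftrightarrow> (\<exists>y. Poly_Mapping.keys y \<subseteq> frag_of ` weak_comps n \<times> frag_of ` weak_comps n \<and>
     z - y \<in> tensor_kernel (\<D> n) (\<D> n))"

lemma reducible_diff:
  assumes "reducible n z" "reducible n z'"
  shows "reducible n (z - z')"
proof -
  let ?B = "frag_of ` weak_comps n \<times> frag_of ` weak_comps n :: ((expvec \<Rightarrow>\<^sub>0 int) \<times> (expvec \<Rightarrow>\<^sub>0 int)) set"
  obtain y y' where y: "Poly_Mapping.keys y \<subseteq> ?B" "z - y \<in> tensor_kernel (\<D> n) (\<D> n)"
    and y': "Poly_Mapping.keys y' \<subseteq> ?B" "z' - y' \<in> tensor_kernel (\<D> n) (\<D> n)"
    using assms unfolding reducible_def by (elim exE conjE)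
  have "Poly_Mapping.keys (y - y') \<subseteq> ?B"
    using order.trans[OF keys_diff Un_least[OF y(1) y'(1)]] .
  moreover have "(z - z') - (y - y') \<in> tensor_kernel (\<D> n) (\<D> n)"
    using tensor_kernel_diff[OF y(2) y'(2)] by (simp add: algebra_simps)
  ultimately show ?thesis
    unfolding reducible_def by (intro exI conjI)
qed

lemma reducible_cong:
  assumes "reducible n z" "z' - z \<in> tensor_kernel (\<D> n) (\<D> n)"
  shows "reducible n z'"
proof -
  obtain y where y: "Poly_Mapping.keys y \<subseteq> frag_of ` weak_comps n \<times> frag_of ` weak_comps n"
    "z - y \<in> tensor_kernel (\<D> n) (\<D> n)"
    using assms(1) unfolding reducible_def by (elim exE conjE)
  have "z' - y \<in> tensor_kernel (\<D> n) (\<D> n)"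
    using tensor_kernel_add[OF assms(2) y(2)] by simp
  with y(1) show ?thesis
    unfolding reducible_def by (intro exI conjI)
qed

lemma reducible_kernel:
  "z \<in> tensor_kernel (\<D> n) (\<D> n) \<Longrightarrow> reducible n z"
  unfolding reducible_def by (intro exI[of _ 0]) simp

lemma dual_mult_eq_add [simp]: "\<alpha> \<otimes>\<^bsub>\<D> n\<^esub> \<beta> = \<alpha> + \<beta>"
  by (simp add: dual_group_def)

lemma mem_carrier_dual_group: "\<alpha> \<in> carrier (\<D> n) \<longleftrightarrow> Poly_Mapping.keys \<alpha> \<subseteq> weak_comps n"
  by (simp add: dual_group_def)

lemma tensor_relation_left:
  assumes "\<alpha> \<in> carrier (\<D> n)" "\<alpha>' \<in> carrier (\<D> n)" "\<beta> \<in> carrier (\<D> n)"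
  shows "frag_of (\<alpha> + \<alpha>', \<beta>) - frag_of (\<alpha>, \<beta>) - frag_of (\<alpha>', \<beta>) \<in> tensor_kernel (\<D> n) (\<D> n)"
  by (rule tensor_relation_in_kernel, unfold tensor_relations_def dual_mult_eq_add, rule UnI1) (use assms in blast)

lemma tensor_relation_right:
  assumes "\<alpha> \<in> carrier (\<D> n)" "\<beta> \<in> carrier (\<D> n)" "\<beta>' \<in> carrier (\<D> n)"
  shows "frag_of (\<alpha>, \<beta> + \<beta>') - frag_of (\<alpha>, \<beta>) - frag_of (\<alpha>, \<beta>') \<in> tensor_kernel (\<D> n) (\<D> n)"
  by (rule tensor_relation_in_kernel, unfold tensor_relations_def dual_mult_eq_add, rule UnI2) (use assms in blast)

lemma carrier_dual_group_diff:
  assumes "\<alpha> \<in> carrier (\<D> n)" "\<beta> \<in> carrier (\<D> n)"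
  shows "\<alpha> - \<beta> \<in> carrier (\<D> n)"
  using assms order.trans[OF keys_diff Un_least] unfolding mem_carrier_dual_group by blast

text \<open>Bilinearity is used one factor at a time: first on the right of a fixed \<open>[a]\<close>, then on the left.\<close>

lemma reducible_frag_of_basis_left:
  assumes a: "a \<in> weak_comps n" and \<beta>: "Poly_Mapping.keys \<beta> \<subseteq> weak_comps n"
  shows "reducible n (frag_of (frag_of a, \<beta>))"
  using \<beta>
proof (induction \<beta> rule: free_Abelian_group_induct[consumes 1, case_names zero diff basis])
  case zero
  have "- frag_of (frag_of a, 0) \<in> tensor_kernel (\<D> n) (\<D> n)"
    using tensor_relation_right[of "frag_of a" n 0 0] a by (simp add: mem_carrier_dual_group)
  then show ?case
    using tensor_kernel_minus reducible_kernel by fastforce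
next
  case (diff \<beta> \<beta>')
  have "frag_of (frag_of a, (\<beta> - \<beta>') + \<beta>') - frag_of (frag_of a, \<beta> - \<beta>') - frag_of (frag_of a, \<beta>')
      \<in> tensor_kernel (\<D> n) (\<D> n)"
    by (rule tensor_relation_right)
      (use diff(1,2) a carrier_dual_group_diff[of \<beta> n \<beta>'] in \<open>simp_all add: mem_carrier_dual_group\<close>)
  then have "- (frag_of (frag_of a, \<beta>) - frag_of (frag_of a, \<beta> - \<beta>') - frag_of (frag_of a, \<beta>'))
      \<in> tensor_kernel (\<D> n) (\<D> n)"
    by (intro tensor_kernel_minus) simp
  then show ?case
    by (intro reducible_cong[OF reducible_diff[OF diff(3,4)]]) (simp add: algebra_simps)
next
  case (basis b)
  then show ?case
    unfolding reducible_def using a subgroup.one_closed[OF tensor_kernel_subgroup]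
    by (intro exI[of _ "frag_of (frag_of a, frag_of b)"]) simp
qed

lemma reducible_frag_of:
  assumes \<alpha>: "Poly_Mapping.keys \<alpha> \<subseteq> weak_comps n" and \<beta>: "Poly_Mapping.keys \<beta> \<subseteq> weak_comps n"
  shows "reducible n (frag_of (\<alpha>, \<beta>))"
  using \<alpha>
proof (induction \<alpha> rule: free_Abelian_group_induct[consumes 1, case_names zero diff basis])
  case zero
  have "- frag_of (0, \<beta>) \<in> tensor_kernel (\<D> n) (\<D> n)"
    using tensor_relation_left[of 0 n 0 \<beta>] \<beta> by (simp add: mem_carrier_dual_group)
  then show ?case
    using tensor_kernel_minus reducible_kernel by fastforce
next
  case (diff \<alpha> \<alpha>')
  have "frag_of ((\<alpha> - \<alpha>') + \<alpha>', \<beta>) - frag_of (\<alpha> - \<alpha>', \<beta>) - frag_of (\<alpha>', \<beta>)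
      \<in> tensor_kernel (\<D> n) (\<D> n)"
    by (rule tensor_relation_left)
      (use diff(1,2) \<beta> carrier_dual_group_diff[of \<alpha> n \<alpha>'] in \<open>simp_all add: mem_carrier_dual_group\<close>)
  then have "- (frag_of (\<alpha>, \<beta>) - frag_of (\<alpha> - \<alpha>', \<beta>) - frag_of (\<alpha>', \<beta>))
      \<in> tensor_kernel (\<D> n) (\<D> n)"
    by (intro tensor_kernel_minus) simp
  then show ?case
    by (intro reducible_cong[OF reducible_diff[OF diff(3,4)]]) (simp add: algebra_simps)
next
  case (basis a)
  then show ?case
    using \<beta> by (rule reducible_frag_of_basis_left)
qed

lemma reducible_all:
  assumes "Poly_Mapping.keys z \<subseteq> carrier (\<D> n) \<times> carrier (\<D> n)"
  shows "reducible n z"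
  using assms
proof (induction z rule: free_Abelian_group_induct[consumes 1, case_names zero diff basis])
  case zero
  then show ?case
    using subgroup.one_closed[OF tensor_kernel_subgroup] by (intro reducible_kernel) simp
next
  case (diff x y)
  show ?case by (rule reducible_diff[OF diff(3,4)])
next
  case (basis p)
  then show ?case
    using reducible_frag_of by (cases p) (simp add: mem_carrier_dual_group)
qed

lemma int_extend_basis_pairs:
  assumes "Poly_Mapping.keys y \<subseteq> frag_of ` weak_comps n \<times> frag_of ` weak_comps n"
  shows "int_extend (\<lambda>(\<alpha>, \<beta>). pairing \<alpha> (monom a 1) * pairing \<beta> (monom b 1)) y
    = Poly_Mapping.lookup y (frag_of a, frag_of b)"
proof -
  let ?p = "(frag_of a, frag_of b)"
  have "int_extend (\<lambda>(\<alpha>, \<beta>). pairing \<alpha> (monom a 1) * pairing \<beta> (monom b 1)) y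
      = (\<Sum>k\<in>Poly_Mapping.keys y. if k = ?p then Poly_Mapping.lookup y k else 0)"
    unfolding int_extend_def
  proof (rule sum.cong[OF refl])
    fix k assume "k \<in> Poly_Mapping.keys y"
    then obtain a' b' where k: "k = (frag_of a', frag_of b')"
      using assms by blast
    show "Poly_Mapping.lookup y k * (case k of (\<alpha>, \<beta>) \<Rightarrow> pairing \<alpha> (monom a 1) * pairing \<beta> (monom b 1))
        = (if k = ?p then Poly_Mapping.lookup y k else 0)"
      by (auto simp: k lookup_single when_def frag_of_eq)
  qed
  also have "\<dots> = Poly_Mapping.lookup y ?p"
    by (simp add: in_keys_iff)
  finally show ?thesis .
qed

text \<open>
  The coefficient of \<open>[a] \<otimes> [b]\<close> in a reduced representative is the pairing with \<open>x\<^sup>a \<otimes> x\<^sup>b\<close>, so two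
  elements with the same pairings have the same representative.
\<close>

lemma tensor_pairing_nondegenerate:
  assumes S: "S \<in> carrier (\<D>\<D> n)" and T: "T \<in> carrier (\<D>\<D> n)"
    and eq: "\<And>a b. a \<in> weak_comps n \<Longrightarrow> b \<in> weak_comps n \<Longrightarrow>
      tensor_pairing S (monom a 1) (monom b 1) = tensor_pairing T (monom a 1) (monom b 1)"
  shows "S = T"
proof -
  let ?F = "free_Abelian_group (carrier (\<D> n) \<times> carrier (\<D> n))"
  let ?N = "tensor_kernel (\<D> n) (\<D> n)"
  have rep: "\<exists>x y. X = ?N #>\<^bsub>?F\<^esub> x \<and> x \<in> carrier ?F \<and> x - y \<in> ?N \<and>
      Poly_Mapping.keys y \<subseteq> frag_of ` weak_comps n \<times> frag_of ` weak_comps n \<and>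
      (\<forall>a b. tensor_pairing X (monom a 1) (monom b 1) = Poly_Mapping.lookup y (frag_of a, frag_of b))"
    if X: "X \<in> carrier (\<D>\<D> n)" for X
  proof -
    obtain x where x: "X = ?N #>\<^bsub>?F\<^esub> x" "x \<in> carrier ?F"
      using X unfolding tensor_group_def carrier_FactGroup by blast
    have "reducible n x"
      using x(2) unfolding carrier_free_Abelian_group_iff by (rule reducible_all)
    then obtain y where y: "Poly_Mapping.keys y \<subseteq> frag_of ` weak_comps n \<times> frag_of ` weak_comps n" "x - y \<in> ?N"
      unfolding reducible_def by (elim exE conjE)
    have "tensor_pairing X (monom a 1) (monom b 1) = Poly_Mapping.lookup y (frag_of a, frag_of b)" for a b
    proof -
      let ?h = "\<lambda>(\<alpha>, \<beta>). pairing \<alpha> (monom a 1) * pairing \<beta> (monom b 1)"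
      have "tensor_pairing X (monom a 1) (monom b 1) = int_extend ?h x"
        unfolding x(1) by (rule tensor_pairing_coset)
      also have "\<dots> = int_extend ?h y"
        using int_extend_tensor_kernel[OF y(2), of "monom a 1" "monom b 1"] by (simp add: int_extend_diff)
      also have "\<dots> = Poly_Mapping.lookup y (frag_of a, frag_of b)"
        by (rule int_extend_basis_pairs[OF y(1)])
      finally show ?thesis .
    qed
    with x y show ?thesis by blast
  qed
  obtain x y where x: "S = ?N #>\<^bsub>?F\<^esub> x" "x \<in> carrier ?F" "x - y \<in> ?N"
    and y: "Poly_Mapping.keys y \<subseteq> frag_of ` weak_comps n \<times> frag_of ` weak_comps n"
      "\<And>a b. tensor_pairing S (monom a 1) (monom b 1) = Poly_Mapping.lookup y (frag_of a, frag_of b)"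
    using rep[OF S] by blast
  obtain x' y' where x': "T = ?N #>\<^bsub>?F\<^esub> x'" "x' \<in> carrier ?F" "x' - y' \<in> ?N"
    and y': "Poly_Mapping.keys y' \<subseteq> frag_of ` weak_comps n \<times> frag_of ` weak_comps n"
      "\<And>a b. tensor_pairing T (monom a 1) (monom b 1) = Poly_Mapping.lookup y' (frag_of a, frag_of b)"
    using rep[OF T] by blast
  have "y = y'"
  proof (rule poly_mapping_eqI)
    fix p
    show "Poly_Mapping.lookup y p = Poly_Mapping.lookup y' p"
    proof (cases "p \<in> frag_of ` weak_comps n \<times> frag_of ` weak_comps n")
      case True
      then show ?thesis using y(2) y'(2) eq by force
    next
      case False
      then have "p \<notin> Poly_Mapping.keys y" "p \<notin> Poly_Mapping.keys y'"
        using y(1) y'(1) by blast+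
      then show ?thesis by (simp add: in_keys_iff)
    qed
  qed
  then have "x' - x \<in> ?N"
    using tensor_kernel_diff[OF x'(3) x(3)] by simp
  then have "(x' - x) \<otimes>\<^bsub>?F\<^esub> x \<in> ?N #>\<^bsub>?F\<^esub> x"
    unfolding r_coset_def by blast
  then have "x' \<in> ?N #>\<^bsub>?F\<^esub> x"
    by simp
  then show ?thesis
    unfolding x(1) x'(1)
    by (rule group.repr_independence[OF group_free_Abelian_group _ x(2) tensor_kernel_subgroup])
qed

section \<open>The coproduct of the dual basis\<close>

lemma coproduct_closed:
  assumes "\<alpha> \<in> carrier (\<D> n)"
  shows "coproduct n \<alpha> \<in> carrier (\<D>\<D> n)"
proof -
  interpret T: comm_group "\<D>\<D> n"
    by (simp add: comm_group_tensor_group)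
  have "tensor (\<D> n) (\<D> n) (frag_of a) (frag_of b) \<in> carrier (\<D>\<D> n)"
    if "a \<in> weak_comps n" "b \<in> weak_comps n" for a b
    using that by (intro tensor_closed) (simp_all add: mem_carrier_dual_group)
  then show ?thesis
    unfolding coproduct_def by (intro T.finprod_closed Pi_I T.int_pow_closed) auto
qed

text \<open>
  Expand both factors in the Schubert basis. A pair outside \<open>F\<close> contributes nothing because its
  structure constant is zero, a pair outside the two supports because \<open>\<epsilon>\<^sub>u f\<close> or \<open>\<epsilon>\<^sub>v g\<close> is zero.
\<close>

lemma schubert_functional_mult:
  assumes w: "w \<in> S_inf"
    and f: "Poly_Mapping.keys f \<subseteq> weak_comps n" and g: "Poly_Mapping.keys g \<subseteq> weak_comps n"
    and F: "finite F" "F \<subseteq> I" "\<And>u v. (u, v) \<in> I \<Longrightarrow> schubert_coeff u v w \<noteq> 0 \<Longrightarrow> (u, v) \<in> F"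
    and I: "I = {(u, v). u \<in> S_inf \<and> v \<in> S_inf \<and> maxd u \<le> n \<and> maxd v \<le> n}"
  shows "\<epsilon> w (f * g) = (\<Sum>(u, v)\<in>F. schubert_coeff u v w * (\<epsilon> u f * \<epsilon> v g))"
proof -
  let ?U = "{u \<in> S_inf. \<epsilon> u f \<noteq> 0}" and ?V = "{v \<in> S_inf. \<epsilon> v g \<noteq> 0}"
  have UV: "?U \<times> ?V \<subseteq> I"
    unfolding I using maxd_le_if_functional_nonzero[OF _ _ f] maxd_le_if_functional_nonzero[OF _ _ g] by blast
  have fin: "finite (?U \<times> ?V)"
    using finite_nonzero_functionals by (intro finite_cartesian_product)
  have "f * g = (\<Sum>u\<in>?U. of_int (\<epsilon> u f) * schubert u) * (\<Sum>v\<in>?V. of_int (\<epsilon> v g) * schubert v)"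
    by (rule arg_cong2[of _ _ _ _ "(*)", OF schubert_expansion[OF keys_subset_weak_comps_avoids_var0[OF f]]
        schubert_expansion[OF keys_subset_weak_comps_avoids_var0[OF g]]])
  also have "\<dots> = (\<Sum>u\<in>?U. \<Sum>v\<in>?V. of_int (\<epsilon> u f * \<epsilon> v g) * (schubert u * schubert v))"
    unfolding sum_product of_int_mult by (simp only: mult.assoc mult.left_commute)
  finally have "\<epsilon> w (f * g) = (\<Sum>u\<in>?U. \<Sum>v\<in>?V. (\<epsilon> u f * \<epsilon> v g) * \<epsilon> w (schubert u * schubert v))"
    by (simp only: schubert_functional_sum[OF w] schubert_functional_of_int_mult[OF w])
  also have "\<dots> = (\<Sum>(u, v)\<in>?U \<times> ?V. (\<epsilon> u f * \<epsilon> v g) * \<epsilon> w (schubert u * schubert v))"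
    by (rule sum.cartesian_product)
  also have "\<dots> = (\<Sum>(u, v)\<in>?U \<times> ?V. schubert_coeff u v w * (\<epsilon> u f * \<epsilon> v g))"
  proof (rule sum.cong[OF refl], clarify)
    fix u v assume "u \<in> S_inf" "v \<in> S_inf"
    then show "\<epsilon> u f * \<epsilon> v g * \<epsilon> w (schubert u * schubert v) = schubert_coeff u v w * (\<epsilon> u f * \<epsilon> v g)"
      using schubert_coeff_eq_functional[OF _ _ w, of u v] by simp
  qed
  also have "\<dots> = (\<Sum>(u, v)\<in>F. schubert_coeff u v w * (\<epsilon> u f * \<epsilon> v g))"
  proof (rule sum.mono_neutral_cong[OF F(1) fin])
    fix p assume "p \<in> F - ?U \<times> ?V"
    then show "(case p of (u, v) \<Rightarrow> schubert_coeff u v w * (\<epsilon> u f * \<epsilon> v g)) = 0"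
      using F(2) unfolding I by (cases p) auto
  next
    fix p assume "p \<in> ?U \<times> ?V - F"
    then have "p \<in> I - F"
      using UV by blast
    then show "(case p of (u, v) \<Rightarrow> schubert_coeff u v w * (\<epsilon> u f * \<epsilon> v g)) = 0"
      using F(3) by (cases p) auto
  qed simp
  finally show ?thesis .
qed

theorem theorem3p2:
  fixes n :: nat and w :: "nat \<Rightarrow> nat"
  assumes "w \<in> S_inf" and "maxd w \<le> n"
  shows "finite {(u, v). u \<in> S_inf \<and> v \<in> S_inf \<and> maxd u \<le> n \<and> maxd v \<le> n \<and>
             schubert_coeff u v w \<noteq> 0}
       \<and> coproduct n (\<Xi> n w) =
           gfinprod (\<D>\<D> n)
             (\<lambda>(u, v). tensor (\<D> n) (\<D> n) (\<Xi> n u) (\<Xi> n v) [^]\<^bsub>\<D>\<D> n\<^esub> schubert_coeff u v w)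
             {(u, v). u \<in> S_inf \<and> v \<in> S_inf \<and> maxd u \<le> n \<and> maxd v \<le> n}"
proof
  let ?I = "{(u, v). u \<in> S_inf \<and> v \<in> S_inf \<and> maxd u \<le> n \<and> maxd v \<le> n}"
  let ?F = "{(u, v). u \<in> S_inf \<and> v \<in> S_inf \<and> maxd u \<le> n \<and> maxd v \<le> n \<and> schubert_coeff u v w \<noteq> 0}"
  let ?t = "\<lambda>(u, v). tensor (\<D> n) (\<D> n) (\<Xi> n u) (\<Xi> n v) [^]\<^bsub>\<D>\<D> n\<^esub> schubert_coeff u v w"
  interpret T: comm_group "\<D>\<D> n"
    by (simp add: comm_group_tensor_group)
  show fin: "finite ?F"
    using assms(1) by (rule finite_nonzero_schubert_coeff)
  have tensor_Xi: "tensor (\<D> n) (\<D> n) (\<Xi> n u) (\<Xi> n v) \<in> carrier (\<D>\<D> n)" if "(u, v) \<in> ?I" for u v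
    using that by (intro tensor_closed dual_schubert(1)) simp_all
  then have t_I: "?t \<in> ?I \<rightarrow> carrier (\<D>\<D> n)"
    by (intro Pi_I) (clarify, intro T.int_pow_closed, blast)
  have FI: "?F \<subseteq> ?I"
    by blast
  have t_F: "?t \<in> ?F \<rightarrow> carrier (\<D>\<D> n)"
    using t_I FI by (rule Pi_anti_mono[THEN subsetD, rotated])
  have "gfinprod (\<D>\<D> n) ?t ?I = gfinprod (\<D>\<D> n) ?t ?F"
  proof (rule T.gfinprod_mono_neutral_cong_right[OF FI _ refl t_I])
    fix p assume "p \<in> ?I - ?F"
    then show "?t p = \<one>\<^bsub>\<D>\<D> n\<^esub>"
      by (cases p) simp
  qed
  also have "\<dots> = finprod (\<D>\<D> n) ?t ?F"
    using fin t_F by (rule T.gfinprod_eq_finprod)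
  finally have gfin: "gfinprod (\<D>\<D> n) ?t ?I = finprod (\<D>\<D> n) ?t ?F" .
  show "coproduct n (\<Xi> n w) = gfinprod (\<D>\<D> n) ?t ?I"
  proof (rule tensor_pairing_nondegenerate)
    show "coproduct n (\<Xi> n w) \<in> carrier (\<D>\<D> n)"
      by (rule coproduct_closed[OF dual_schubert(1)[OF assms]])
    show "gfinprod (\<D>\<D> n) ?t ?I \<in> carrier (\<D>\<D> n)"
      using t_I by (rule T.gfinprod_closed)
    fix a b assume ab: "a \<in> weak_comps n" "b \<in> weak_comps n"
    let ?f = "monom a 1" and ?g = "monom b 1"
    have f: "Poly_Mapping.keys ?f \<subseteq> weak_comps n" and g: "Poly_Mapping.keys ?g \<subseteq> weak_comps n"
      using ab by simp_all
    interpret h: group_hom "\<D>\<D> n" integer_group "\<lambda>T. tensor_pairing T ?f ?g"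
      by (simp add: group_hom_def group_hom_axioms_def tensor_pairing_hom T.is_group)
    have t_pair: "tensor_pairing (?t (u, v)) ?f ?g = schubert_coeff u v w * (\<epsilon> u ?f * \<epsilon> v ?g)"
      if "(u, v) \<in> ?F" for u v
    proof -
      have uv: "u \<in> S_inf" "maxd u \<le> n" "v \<in> S_inf" "maxd v \<le> n"
        using that by simp_all
      have "tensor (\<D> n) (\<D> n) (\<Xi> n u) (\<Xi> n v) \<in> carrier (\<D>\<D> n)"
        using uv by (intro tensor_Xi) simp
      then show ?thesis
        by (simp add: h.hom_int_pow tensor_pairing_tensor dual_schubert(2)[OF uv(1,2) f]
            dual_schubert(2)[OF uv(3,4) g])
    qed
    have "tensor_pairing (coproduct n (\<Xi> n w)) ?f ?g = pairing (\<Xi> n w) (?f * ?g)"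
      by (rule tensor_pairing_coproduct[OF dual_schubert(1)[OF assms]])
    also have "\<dots> = \<epsilon> w (?f * ?g)"
      by (rule dual_schubert(2)[OF assms keys_mult_weak_comps[OF f g]])
    also have "\<dots> = (\<Sum>(u, v)\<in>?F. schubert_coeff u v w * (\<epsilon> u ?f * \<epsilon> v ?g))"
      by (rule schubert_functional_mult[OF assms(1) f g fin FI _ refl]) simp
    also have "\<dots> = (\<Sum>p\<in>?F. tensor_pairing (?t p) ?f ?g)"
    proof (rule sum.cong[OF refl])
      fix p assume "p \<in> ?F"
      then show "(case p of (u, v) \<Rightarrow> schubert_coeff u v w * (\<epsilon> u ?f * \<epsilon> v ?g)) = tensor_pairing (?t p) ?f ?g"
        using t_pair[of "fst p" "snd p"] by (cases p) simp
    qed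
    also have "\<dots> = tensor_pairing (gfinprod (\<D>\<D> n) ?t ?I) ?f ?g"
      unfolding gfin by (rule tensor_pairing_finprod[OF fin t_F, symmetric])
    finally show "tensor_pairing (coproduct n (\<Xi> n w)) ?f ?g = tensor_pairing (gfinprod (\<D>\<D> n) ?t ?I) ?f ?g" .
  qed
qed

end
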